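(* Let $\mathcal{V}$ be a Mono-vEB tree over the universe $[0,U)$ and let $B_{\mathit{in}}$ be a batch of points $\langle x_i,y_i,\mathit{dp}_i\rangle$ sorted by $y_i$. Let $B_{\mathit{out}}$ be the set of points of $\mathcal{V}$ that are covered by at least one point of $B_{\mathit{in}}$. Then $B_{\mathit{out}}$, in sorted order of keys, can be computed in parallel in $O(m\log\log U)$ work and $O(\log U\log\log U)$ span, where $m=|B_{\mathit{in}}|+|B_{\mathit{out}}|$.
   Context: A point is a triple $\langle x,y,\mathit{dp}\rangle$; a point $p_1=\langle x_1,y_1,\mathit{dp}_1\rangle$ covers $p_2=\langle x_2,y_2,\mathit{dp}_2\rangle$ if $y_1<y_2$ and $\mathit{dp}_1\ge\mathit{dp}_2$. A Mono-vEB tree is a van Emde Boas tree (over integer keys in $[0,U)$, supporting predecessor and successor in $O(\log\log U)$ work) storing a set of points keyed by their $y$-coordinate, with each key carrying its point's $\mathit{dp}$ value as a score, such that no stored point covers another; equivalently, scores are strictly increasing with keys. Model: binary-forking work-span model (work = total operations, span = longest chain of sequentially dependent operations).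
   Formalization: The batch is assumed to have keys y_i in [0,U) and at most U points (automatic for distinct keys); with unboundedly many batch points sharing a key the span bound fails, as span is at least logarithmic in |B_in|. U > 2 is assumed and m is read as max(1,m). *)

theory Defs
  imports Complex_Main "HOL-Library.Log_Nat"
begin

section \<open>A binary-forking word RAM\<close>

text \<open>
  Programs are finite lists of recursive procedures over a shared memory.  Every procedure call
  has its own frame of registers.  The only parallel construct runs two procedure calls as
  siblings and joins them.  Arithmetic costs one unit per operation, and a step is possible only
  if every value that it computes is a machine word, that is, bounded by \<open>W\<close> in absolute value;
  so unit-cost arithmetic cannot be abused to pack large amounts of data into one integer.
\<close>

datatype binop = Add | Sub | Mul | Quot | Rem | Shl | Shr | Less | Equal

fun apply_op :: "binop \<Rightarrow> int \<Rightarrow> int \<Rightarrow> int" where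
  "apply_op Add x y = x + y"
| "apply_op Sub x y = x - y"
| "apply_op Mul x y = x * y"
| "apply_op Quot x y = x div y"
| "apply_op Rem x y = x mod y"
| "apply_op Shl x y = x * 2 ^ nat y"
| "apply_op Shr x y = x div 2 ^ nat y"
| "apply_op Less x y = (if x < y then 1 else 0)"
| "apply_op Equal x y = (if x = y then 1 else 0)"

datatype exp = Const int | Reg nat | Op binop exp exp

type_synonym regs = "nat \<Rightarrow> int"
type_synonym mem = "int \<Rightarrow> int"

fun val :: "exp \<Rightarrow> regs \<Rightarrow> int" where
  "val (Const i) s = i"
| "val (Reg r) s = s r"
| "val (Op p e1 e2) s = apply_op p (val e1 s) (val e2 s)"

fun fits :: "int \<Rightarrow> exp \<Rightarrow> regs \<Rightarrow> bool" where
  "fits W (Const i) s \<longleftrightarrow> \<bar>i\<bar> \<le> W"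
| "fits W (Reg r) s \<longleftrightarrow> \<bar>s r\<bar> \<le> W"
| "fits W (Op p e1 e2) s \<longleftrightarrow> fits W e1 s \<and> fits W e2 s \<and> \<bar>val (Op p e1 e2) s\<bar> \<le> W"

fun exp_cost :: "exp \<Rightarrow> nat" where
  "exp_cost (Const i) = 1"
| "exp_cost (Reg r) = 1"
| "exp_cost (Op p e1 e2) = 1 + exp_cost e1 + exp_cost e2"

definition args_cost :: "exp list \<Rightarrow> nat" where
  "args_cost es = sum_list (map exp_cost es)"

datatype com =
    Skip
  | Assign nat exp
  | Load nat exp
  | Store exp exp
  | Seq com com
  | Cond exp com com
  | While exp com
  | Call nat nat "exp list"
  | Fork nat nat "exp list" nat nat "exp list"

type_synonym program = "com list"

text \<open>
  \<^term>\<open>Call r p es\<close> calls procedure \<open>p\<close> and puts its result into register \<open>r\<close>;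
  \<^term>\<open>Fork r1 p1 es1 r2 p2 es2\<close> runs two such calls in parallel.  Arguments are passed in the
  first registers of the new frame; the result is the final content of its register 0.
\<close>

definition frame :: "int list \<Rightarrow> regs" where
  "frame vs = (\<lambda>r. if r < length vs then vs ! r else 0)"

text \<open>
  An outcome \<open>(s', M', w, d, R, X)\<close> consists of the final registers, the final memory, the work,
  the span, and the sets of memory addresses read and written.  A fork is possible only
  if its two branches are free of races (no address written by one is read or written by the
  other).  Both branches then start from the same memory, and their writes are merged; by race
  freedom, this is also the effect of every interleaving.
\<close>

inductive exec ::
  "int \<Rightarrow> program \<Rightarrow> com \<times> regs \<times> mem \<Rightarrow> regs \<times> mem \<times> nat \<times> nat \<times> int set \<times> int set \<Rightarrow> bool"
  for W :: int and \<Pi> :: program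
where
  Skip: "exec W \<Pi> (Skip, s, M) (s, M, 1, 1, {}, {})"
| Assign: "fits W e s \<Longrightarrow>
    exec W \<Pi> (Assign r e, s, M) (s(r := val e s), M, 1 + exp_cost e, 1 + exp_cost e, {}, {})"
| Load: "fits W e s \<Longrightarrow>
    exec W \<Pi> (Load r e, s, M)
      (s(r := M (val e s)), M, 1 + exp_cost e, 1 + exp_cost e, {val e s}, {})"
| Store: "fits W e s \<Longrightarrow> fits W e' s \<Longrightarrow>
    exec W \<Pi> (Store e e', s, M)
      (s, M(val e s := val e' s), 1 + exp_cost e + exp_cost e', 1 + exp_cost e + exp_cost e',
       {}, {val e s})"
| Seq: "exec W \<Pi> (c1, s, M) (s1, M1, w1, d1, R1, X1) \<Longrightarrow>
    exec W \<Pi> (c2, s1, M1) (s2, M2, w2, d2, R2, X2) \<Longrightarrow>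
    exec W \<Pi> (Seq c1 c2, s, M) (s2, M2, w1 + w2, d1 + d2, R1 \<union> R2, X1 \<union> X2)"
| Cond: "fits W e s \<Longrightarrow>
    exec W \<Pi> (if val e s \<noteq> 0 then c1 else c2, s, M) (s', M', w, d, R, X) \<Longrightarrow>
    exec W \<Pi> (Cond e c1 c2, s, M) (s', M', 1 + exp_cost e + w, 1 + exp_cost e + d, R, X)"
| While_False: "fits W e s \<Longrightarrow> val e s = 0 \<Longrightarrow>
    exec W \<Pi> (While e c, s, M) (s, M, 1 + exp_cost e, 1 + exp_cost e, {}, {})"
| While_True: "fits W e s \<Longrightarrow> val e s \<noteq> 0 \<Longrightarrow>
    exec W \<Pi> (Seq c (While e c), s, M) (s', M', w, d, R, X) \<Longrightarrow>
    exec W \<Pi> (While e c, s, M) (s', M', 1 + exp_cost e + w, 1 + exp_cost e + d, R, X)"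
| Call: "\<forall>e\<in>set es. fits W e s \<Longrightarrow> p < length \<Pi> \<Longrightarrow>
    exec W \<Pi> (\<Pi> ! p, frame (map (\<lambda>e. val e s) es), M) (s', M', w, d, R, X) \<Longrightarrow>
    exec W \<Pi> (Call r p es, s, M)
      (s(r := s' 0), M', 1 + args_cost es + w, 1 + args_cost es + d, R, X)"
| Fork: "\<forall>e\<in>set es1 \<union> set es2. fits W e s \<Longrightarrow> p1 < length \<Pi> \<Longrightarrow> p2 < length \<Pi> \<Longrightarrow>
    exec W \<Pi> (\<Pi> ! p1, frame (map (\<lambda>e. val e s) es1), M) (s1, M1, w1, d1, R1, X1) \<Longrightarrow>
    exec W \<Pi> (\<Pi> ! p2, frame (map (\<lambda>e. val e s) es2), M) (s2, M2, w2, d2, R2, X2) \<Longrightarrow>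
    X1 \<inter> (R2 \<union> X2) = {} \<Longrightarrow> X2 \<inter> (R1 \<union> X1) = {} \<Longrightarrow>
    exec W \<Pi> (Fork r1 p1 es1 r2 p2 es2, s, M)
      (s(r1 := s1 0, r2 := s2 0), (\<lambda>a. if a \<in> X1 then M1 a else if a \<in> X2 then M2 a else M a),
       1 + args_cost es1 + args_cost es2 + (w1 + w2),
       1 + args_cost es1 + args_cost es2 + max d1 d2,
       R1 \<union> R2, X1 \<union> X2)"

lemma exec_deterministic:
  "exec W \<Pi> cfg out \<Longrightarrow> exec W \<Pi> cfg out' \<Longrightarrow> out' = out"
proof (induction arbitrary: out' rule: exec.induct)
  case (Seq c1 s M s1 M1 w1 d1 R1 X1 c2 s2 M2 w2 d2 R2 X2)
  from Seq.prems show ?case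
    by cases (use Seq.IH in fastforce)
next
  case (Fork es1 es2 s p1 p2 M s1 M1 w1 d1 R1 X1 s2 M2 w2 d2 R2 X2 r1 r2)
  from Fork.prems show ?case
    by cases (use Fork.IH in fastforce)
next
  case (Cond e s c1 c2 M s' M' w d R X)
  from Cond.prems show ?case
    by cases (use Cond.IH in fastforce)
next
  case (While_True e s c M s' M' w d R X)
  from While_True.prems show ?case
    by cases (use While_True.IH While_True.hyps in fastforce)+
next
  case (Call es s p M s' M' w d R X r)
  from Call.prems show ?case
    by cases (use Call.IH in fastforce)
qed (auto elim: exec.cases)

text \<open>A run starts with procedure 0 and returns the final content of its register 0; its work is \<open>w\<close>,
  its span \<open>d\<close>.\<close>

definition run :: "int \<Rightarrow> program \<Rightarrow> int list \<Rightarrow> mem \<Rightarrow> int \<Rightarrow> mem \<Rightarrow> nat \<Rightarrow> nat \<Rightarrow> bool" where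
  "run W \<Pi> args M r M' w d \<longleftrightarrow>
     0 < length \<Pi> \<and>
     (\<exists>s R X. exec W \<Pi> (\<Pi> ! 0, frame args, M) (s, M', w, d, R, X) \<and> r = s 0)"


section \<open>Points and the covering relation\<close>

type_synonym point = "int \<times> nat \<times> int"

fun px :: "point \<Rightarrow> int" where "px (x, y, dp) = x"
fun py :: "point \<Rightarrow> nat" where "py (x, y, dp) = y"
fun pdp :: "point \<Rightarrow> int" where "pdp (x, y, dp) = dp"

definition covers :: "point \<Rightarrow> point \<Rightarrow> bool" where
  "covers p q \<longleftrightarrow> py p < py q \<and> pdp p \<ge> pdp q"

definition covered_by :: "point set \<Rightarrow> point list \<Rightarrow> point set" where
  "covered_by P B = {q \<in> P. \<exists>p \<in> set B. covers p q}"

text \<open>Arrays of points, three words per point.\<close>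

definition points_at :: "mem \<Rightarrow> int \<Rightarrow> point list \<Rightarrow> bool" where
  "points_at M a L \<longleftrightarrow>
     (\<forall>i < length L.
        M (a + 3 * int i) = px (L ! i) \<and>
        M (a + 3 * int i + 1) = int (py (L ! i)) \<and>
        M (a + 3 * int i + 2) = pdp (L ! i))"


section \<open>Van Emde Boas trees\<close>

text \<open>
  \<open>veb_at M f k a S\<close>: the node at address \<open>a\<close> of memory \<open>M\<close> is the root of a van Emde Boas tree
  over the universe \<open>{0..<2^k}\<close> storing the set \<open>S\<close>, and the tree lies below address \<open>f\<close>.
  A node has five words: \<open>k\<close>, the minimum, the maximum (\<open>-1\<close> if \<open>S\<close> is empty), a pointer to
  the summary, and a pointer to an array of pointers to the clusters.  As usual, a key \<open>y\<close> is
  split into its upper \<open>\<lceil>k/2\<rceil>\<close> bits, which select the cluster, and its lower \<open>\<lfloor>k/2\<rfloor>\<close> bits, which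
  are stored there; the minimum is not stored in any cluster; and the summary stores the
  indices of the nonempty clusters.
\<close>

fun veb_at :: "mem \<Rightarrow> int \<Rightarrow> nat \<Rightarrow> int \<Rightarrow> nat set \<Rightarrow> bool" where
  "veb_at M f k a S \<longleftrightarrow>
     S \<subseteq> {..<2 ^ k} \<and> 0 \<le> a \<and> a + 5 \<le> f \<and>
     M a = int k \<and>
     M (a + 1) = (if S = {} then -1 else int (Min S)) \<and>
     M (a + 2) = (if S = {} then -1 else int (Max S)) \<and>
     (if k \<le> 1 then True
      else
        veb_at M f ((k + 1) div 2) (M (a + 3)) ((\<lambda>y. y div 2 ^ (k div 2)) ` (S - {Min S})) \<and>
        0 \<le> M (a + 4) \<and> M (a + 4) + 2 ^ ((k + 1) div 2) \<le> f \<and>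
        (\<forall>i < 2 ^ ((k + 1) div 2).
           veb_at M f (k div 2) (M (M (a + 4) + int i))
             {y. y < 2 ^ (k div 2) \<and> i * 2 ^ (k div 2) + y \<in> S - {Min S}}))"

declare veb_at.simps [simp del]

text \<open>
  A Mono-vEB tree over \<open>[0,U)\<close>, with root \<open>v\<close>, storing the point set \<open>P\<close>: the keys are
  kept in a van Emde Boas tree, whose universe is rounded up to a power of two, and the data that
  a key carries (its \<open>x\<close> and its score \<open>dp\<close>) is found in a table at \<open>t\<close> that is addressed by key.
\<close>

definition mono_points :: "nat \<Rightarrow> point set \<Rightarrow> bool" where
  "mono_points U P \<longleftrightarrow>
     (\<forall>p \<in> P. py p < U) \<and> inj_on py P \<and> (\<forall>p \<in> P. \<forall>q \<in> P. \<not> covers p q)"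

definition mono_veb_at :: "mem \<Rightarrow> int \<Rightarrow> nat \<Rightarrow> int \<Rightarrow> int \<Rightarrow> point set \<Rightarrow> bool" where
  "mono_veb_at M f U v t P \<longleftrightarrow>
     mono_points U P \<and>
     veb_at M f (ceillog2 U) v (py ` P) \<and>
     0 \<le> t \<and> t + 2 * int U \<le> f \<and>
     (\<forall>p \<in> P. M (t + 2 * int (py p)) = px p \<and> M (t + 2 * int (py p) + 1) = pdp p)"

end

theory Submission
  imports Defs
begin

text \<open>
  Let \<open>y\<^sub>0 \<le> y\<^sub>1 \<le> \<dots>\<close> be the batch keys and \<open>d\<^sub>i\<close> the maximum of the first \<open>i + 1\<close> batch scores.  A
  stored key in \<open>(y\<^sub>i, y\<^sub>i\<^sub>+\<^sub>1]\<close> is covered iff its score is at most \<open>d\<^sub>i\<close>, and since scores increase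
  with keys, the covered keys form an initial segment of that interval.  To enumerate it in
  \<open>(lo, hi]\<close>, find the successor \<open>s\<close> of \<open>lo\<close>; stop if \<open>s > hi\<close> or \<open>s\<close> is not covered, and otherwise
  report \<open>s\<close> and treat the two halves of \<open>(s, hi]\<close> in parallel.  Every call but the failing leaves
  reports a key, so there are at most \<open>2 m + 1\<close> calls per interval with output \<open>m\<close>, and the
  recursion depth is logarithmic because the interval halves.  Prefix maxima come from a parallel
  scan.  The calls leave behind a binary tree with subtree sizes, which a second parallel pass
  flattens into the output array.
\<close>

section \<open>Weakest preconditions for the word RAM\<close>

text \<open>The obstacle is coordination. Forked branches may not touch a word that the other
  writes, there is no allocator, and words are bounded, so a branch that finds a key cannot know its
  place in the output. Hence two passes: the search leaves its own recursion tree in memory at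
  addresses computed from keys and split positions, and only then do subtree sizes determine output
  positions. Disjoint key intervals own disjoint address ranges, which is the core of every
  race-freedom argument. Every procedure forks before it stores anything itself, so both branches
  see the memory with which their parent was entered, and one fixed \<open>M\<close> serves a whole
  recursion.

  The intervals are open on the left and closed on the right because \<open>covers\<close> is strict
  in the key: a batch point covers no key equal to its own. Repeated batch keys merely produce empty
  intervals.

  Span adds the batch levels and the key levels, each at most about \<open>log 2 U\<close> since the
  batch has at most \<open>U\<close> points, and each level costs one successor query.\<close>

lemma exec_unwritten:
  assumes "exec W \<Pi> cfg out" "cfg = (c, s, M)" "out = (s', M', w, d, R, X)" "a \<notin> X"
  shows "M' a = M a"
  using assms
proof (induction arbitrary: c s M s' M' w d R X rule: exec.induct)
qed (auto split: if_splits)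

type_synonym post = "regs \<Rightarrow> mem \<Rightarrow> nat \<Rightarrow> nat \<Rightarrow> int set \<Rightarrow> int set \<Rightarrow> bool"

text \<open>Total correctness: a run has to exist, so all word bounds and race conditions are part
  of the claim, and by determinism of \<open>exec\<close> this run is the only one. Costs and
  footprints are arguments of the postcondition, so that one induction can establish them together
  with the result.\<close>

definition wp :: "int \<Rightarrow> program \<Rightarrow> com \<Rightarrow> regs \<Rightarrow> mem \<Rightarrow> post \<Rightarrow> bool" where
  "wp W \<Pi> c s M Q \<longleftrightarrow>
     (\<exists>s' M' w d R X. exec W \<Pi> (c, s, M) (s', M', w, d, R, X) \<and> Q s' M' w d R X)"

definition wp_proc ::
  "int \<Rightarrow> program \<Rightarrow> nat \<Rightarrow> int list \<Rightarrow> mem \<Rightarrow>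
   (int \<Rightarrow> mem \<Rightarrow> nat \<Rightarrow> nat \<Rightarrow> int set \<Rightarrow> int set \<Rightarrow> bool) \<Rightarrow> bool" where
  "wp_proc W \<Pi> p vs M Q \<longleftrightarrow>
     p < length \<Pi> \<and> wp W \<Pi> (\<Pi> ! p) (frame vs) M (\<lambda>s'. Q (s' 0))"

lemma wpI: "exec W \<Pi> (c, s, M) (s', M', w, d, R, X) \<Longrightarrow> Q s' M' w d R X \<Longrightarrow> wp W \<Pi> c s M Q"
  unfolding wp_def by iprover

lemma wpE:
  assumes "wp W \<Pi> c s M Q"
  obtains s' M' w d R X where "exec W \<Pi> (c, s, M) (s', M', w, d, R, X)" "Q s' M' w d R X"
  using assms unfolding wp_def by iprover

inductive_simps exec_simps:
  "exec W \<Pi> (Skip, s, M) (s', M', w, d, R, X)"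
  "exec W \<Pi> (Assign r e, s, M) (s', M', w, d, R, X)"
  "exec W \<Pi> (Load r e, s, M) (s', M', w, d, R, X)"
  "exec W \<Pi> (Store e e', s, M) (s', M', w, d, R, X)"
  "exec W \<Pi> (Seq c1 c2, s, M) (s', M', w, d, R, X)"
  "exec W \<Pi> (Cond e c1 c2, s, M) (s', M', w, d, R, X)"
  "exec W \<Pi> (Call r p es, s, M) (s', M', w, d, R, X)"

text \<open>Stating the rules for sequential commands as equivalences lets the simplifier execute
  code symbolically and add up its cost.\<close>

lemma wp_Skip [simp]: "wp W \<Pi> Skip s M Q \<longleftrightarrow> Q s M 1 1 {} {}"
  unfolding wp_def exec_simps by simp

lemma wp_Assign [simp]:
  "wp W \<Pi> (Assign r e) s M Q \<longleftrightarrow>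
     fits W e s \<and> Q (s(r := val e s)) M (1 + exp_cost e) (1 + exp_cost e) {} {}"
  unfolding wp_def exec_simps by simp

lemma wp_Load [simp]:
  "wp W \<Pi> (Load r e) s M Q \<longleftrightarrow>
     fits W e s \<and> Q (s(r := M (val e s))) M (1 + exp_cost e) (1 + exp_cost e) {val e s} {}"
  unfolding wp_def exec_simps by simp

lemma wp_Store [simp]:
  "wp W \<Pi> (Store e e') s M Q \<longleftrightarrow>
     fits W e s \<and> fits W e' s \<and>
     Q s (M(val e s := val e' s)) (1 + exp_cost e + exp_cost e') (1 + exp_cost e + exp_cost e')
       {} {val e s}"
  unfolding wp_def exec_simps by simp

lemma wp_Seq [simp]:
  "wp W \<Pi> (Seq c1 c2) s M Q \<longleftrightarrow>
     wp W \<Pi> c1 s M (\<lambda>s1 M1 w1 d1 R1 X1.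
       wp W \<Pi> c2 s1 M1 (\<lambda>s2 M2 w2 d2 R2 X2.
         Q s2 M2 (w1 + w2) (d1 + d2) (R1 \<union> R2) (X1 \<union> X2)))"
  (is "?L \<longleftrightarrow> ?R")
proof
  assume ?L
  then show ?R
    unfolding exec_simps wp_def[of _ _ "Seq c1 c2"]
    by (elim exE conjE) (hypsubst, (rule wpI, assumption)+)
next
  assume ?R
  then show ?L
    by (elim wpE) (rule wpI[OF exec.Seq])
qed

lemma wp_Cond [simp]:
  "wp W \<Pi> (Cond e c1 c2) s M Q \<longleftrightarrow>
     fits W e s \<and>
     wp W \<Pi> (if val e s \<noteq> 0 then c1 else c2) s M
       (\<lambda>s' M' w d. Q s' M' (1 + exp_cost e + w) (1 + exp_cost e + d))"
  (is "?L \<longleftrightarrow> ?R")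
proof
  assume ?L
  then show ?R
    unfolding exec_simps wp_def[of _ _ "Cond e c1 c2"]
    by (elim exE conjE) (hypsubst, rule conjI, assumption, rule wpI, assumption, simp)
next
  assume ?R
  then show ?L
    by (elim conjE wpE) (rule wpI[OF exec.Cond])
qed

lemma wp_Call [simp]:
  "wp W \<Pi> (Call r p es) s M Q \<longleftrightarrow>
     (\<forall>e\<in>set es. fits W e s) \<and>
     wp_proc W \<Pi> p (map (\<lambda>e. val e s) es) M
       (\<lambda>v M' w d. Q (s(r := v)) M' (1 + args_cost es + w) (1 + args_cost es + d))"
  (is "?L \<longleftrightarrow> ?R")
proof
  assume ?L
  then show ?R
    unfolding exec_simps wp_def[of _ _ "Call r p es"] wp_proc_def
    by (elim exE conjE) (hypsubst, intro conjI, assumption+, rule wpI, assumption, simp)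
next
  assume ?R
  then show ?L
    unfolding wp_proc_def by (elim conjE wpE) (rule wpI[OF exec.Call])
qed

text \<open>An introduction rule, because a postcondition has to be chosen for each branch. The
  merged memory agrees with either branch off the other one's write set: an address written by
  neither keeps its initial content in all three memories, by \<open>exec_unwritten\<close>.\<close>

lemma wp_Fork:
  assumes fits: "\<forall>e\<in>set es1 \<union> set es2. fits W e s"
    and vs1: "map (\<lambda>e. val e s) es1 = vs1" and P1: "wp_proc W \<Pi> p1 vs1 M Q1"
    and vs2: "map (\<lambda>e. val e s) es2 = vs2" and P2: "wp_proc W \<Pi> p2 vs2 M Q2"
    and race: "\<And>v1 M1 w1 d1 R1 X1 v2 M2 w2 d2 R2 X2.
      Q1 v1 M1 w1 d1 R1 X1 \<Longrightarrow> Q2 v2 M2 w2 d2 R2 X2 \<Longrightarrow>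
      X1 \<inter> (R2 \<union> X2) = {} \<and> X2 \<inter> (R1 \<union> X1) = {}"
    and Q: "\<And>v1 M1 w1 d1 R1 X1 v2 M2 w2 d2 R2 X2 M'.
      Q1 v1 M1 w1 d1 R1 X1 \<Longrightarrow> Q2 v2 M2 w2 d2 R2 X2 \<Longrightarrow>
      (\<And>a. a \<notin> X2 \<Longrightarrow> M' a = M1 a) \<Longrightarrow> (\<And>a. a \<notin> X1 \<Longrightarrow> M' a = M2 a) \<Longrightarrow>
      Q (s(r1 := v1, r2 := v2)) M' (1 + args_cost es1 + args_cost es2 + (w1 + w2))
        (1 + args_cost es1 + args_cost es2 + max d1 d2) (R1 \<union> R2) (X1 \<union> X2)"
  shows "wp W \<Pi> (Fork r1 p1 es1 r2 p2 es2) s M Q"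
proof -
  from P1 obtain s1 M1 w1 d1 R1 X1 where
    e1: "p1 < length \<Pi>"
      "exec W \<Pi> (\<Pi> ! p1, frame (map (\<lambda>e. val e s) es1), M) (s1, M1, w1, d1, R1, X1)"
    and q1: "Q1 (s1 0) M1 w1 d1 R1 X1"
    unfolding wp_proc_def wp_def vs1 by blast
  from P2 obtain s2 M2 w2 d2 R2 X2 where
    e2: "p2 < length \<Pi>"
      "exec W \<Pi> (\<Pi> ! p2, frame (map (\<lambda>e. val e s) es2), M) (s2, M2, w2, d2, R2, X2)"
    and q2: "Q2 (s2 0) M2 w2 d2 R2 X2"
    unfolding wp_proc_def wp_def vs2 by blast
  let ?M = "\<lambda>a. if a \<in> X1 then M1 a else if a \<in> X2 then M2 a else M a"
  have "?M a = M1 a" if "a \<notin> X2" for a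
    using that exec_unwritten[OF e1(2) refl refl] by auto
  moreover have "?M a = M2 a" if "a \<notin> X1" for a
    using that exec_unwritten[OF e2(2) refl refl] by auto
  ultimately have "Q (s(r1 := s1 0, r2 := s2 0)) ?M (1 + args_cost es1 + args_cost es2 + (w1 + w2))
        (1 + args_cost es1 + args_cost es2 + max d1 d2) (R1 \<union> R2) (X1 \<union> X2)"
    by (intro Q[OF q1 q2])
  moreover have "X1 \<inter> (R2 \<union> X2) = {}" "X2 \<inter> (R1 \<union> X1) = {}"
    using race[OF q1 q2] by auto
  ultimately show ?thesis
    unfolding wp_def using exec.Fork[OF fits e1(1) e2(1) e1(2) e2(2)] by blast
qed

text \<open>Weakening comes with the frame property built in, so postconditions need not list what
  stays unchanged.\<close>

lemma wp_mono:
  assumes "wp W \<Pi> c s M Q"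
    and "\<And>s' M' w d R X. (\<And>a. a \<notin> X \<Longrightarrow> M' a = M a) \<Longrightarrow> Q s' M' w d R X \<Longrightarrow> Q' s' M' w d R X"
  shows "wp W \<Pi> c s M Q'"
  using assms(1) by (elim wpE) (rule wpI, assumption, rule assms(2), rule exec_unwritten, auto)

lemma wp_proc_mono:
  assumes "wp_proc W \<Pi> p vs M Q"
    and "\<And>v M' w d R X. (\<And>a. a \<notin> X \<Longrightarrow> M' a = M a) \<Longrightarrow> Q v M' w d R X \<Longrightarrow> Q' v M' w d R X"
  shows "wp_proc W \<Pi> p vs M Q'"
proof -
  from assms(1) obtain s' M' w d R X where
    *: "p < length \<Pi>" "exec W \<Pi> (\<Pi> ! p, frame vs, M) (s', M', w, d, R, X)" "Q (s' 0) M' w d R X"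
    unfolding wp_proc_def wp_def by blast
  have "Q' (s' 0) M' w d R X"
    using exec_unwritten[OF *(2) refl refl] *(3) by (intro assms(2)) auto
  then show ?thesis using * unfolding wp_proc_def wp_def by blast
qed

lemma frame_simps [simp]:
  "frame (v # vs) 0 = v"
  "frame (v # vs) (Suc i) = frame vs i"
  "frame (v # vs) (numeral m) = frame vs (pred_numeral m)"
  by (auto simp: frame_def numeral_eq_Suc)

fun seqs :: "com list \<Rightarrow> com" where
  "seqs [] = Skip"
| "seqs [c] = c"
| "seqs (c # cs) = Seq c (seqs cs)"

section \<open>Successor search\<close>

text \<open>At most one recursive call per node. The stored maximum of the cluster of the key
  decides in constant time between cluster and summary, and the minimum of a cluster found through
  the summary is read off its root.\<close>

definition succ_proc :: com where
  "succ_proc =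
    Seq (Load 2 (Reg 0))
    (Cond (Op Less (Reg 2) (Const 2))
      (Seq (Load 3 (Op Add (Reg 0) (Const 2)))
        (Cond (Op Less (Reg 1) (Reg 3)) (Assign 0 (Reg 3)) (Assign 0 (Const (-1)))))
      (Seq (Load 3 (Op Add (Reg 0) (Const 1)))
        (Cond (Op Less (Reg 1) (Reg 3)) (Assign 0 (Reg 3))
          (seqs [
            Assign 4 (Op Quot (Reg 2) (Const 2)),
            Assign 5 (Op Shr (Reg 1) (Reg 4)),
            Assign 6 (Op Sub (Reg 1) (Op Shl (Reg 5) (Reg 4))),
            Load 7 (Op Add (Reg 0) (Const 4)),
            Load 8 (Op Add (Reg 7) (Reg 5)),
            Load 9 (Op Add (Reg 8) (Const 2)),
            Cond (Op Less (Reg 6) (Reg 9))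
              (Seq (Call 10 1 [Reg 8, Reg 6])
                (Assign 0 (Op Add (Op Shl (Reg 5) (Reg 4)) (Reg 10))))
              (seqs [
                Load 8 (Op Add (Reg 0) (Const 3)),
                Call 10 1 [Reg 8, Reg 5],
                Cond (Op Less (Reg 10) (Const 0)) (Assign 0 (Const (-1)))
                  (seqs [
                    Load 8 (Op Add (Reg 7) (Reg 10)),
                    Load 9 (Op Add (Reg 8) (Const 1)),
                    Assign 0 (Op Add (Op Shl (Reg 10) (Reg 4)) (Reg 9))])])]))))"

section \<open>Strict successors, and their reduction to clusters and summary\<close>

definition is_succ :: "nat set \<Rightarrow> nat \<Rightarrow> int \<Rightarrow> bool" where
  "is_succ S x r \<longleftrightarrow>
     (r = -1 \<and> (\<forall>y\<in>S. y \<le> x)) \<or>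
     (\<exists>y\<in>S. r = int y \<and> x < y \<and> (\<forall>z\<in>S. x < z \<longrightarrow> y \<le> z))"

lemma is_succI:
  "y \<in> S \<Longrightarrow> x < y \<Longrightarrow> (\<And>z. z \<in> S \<Longrightarrow> x < z \<Longrightarrow> y \<le> z) \<Longrightarrow> is_succ S x (int y)"
  unfolding is_succ_def by blast

abbreviation cluster :: "nat set \<Rightarrow> nat \<Rightarrow> nat \<Rightarrow> nat set" where
  "cluster S b i \<equiv> {y. y < b \<and> i * b + y \<in> S}"

text \<open>An element above \<open>x\<close> in another cluster lies in a higher one, hence beyond
  everything in the cluster of \<open>x\<close>. The witness \<open>y\<close> excludes the answer
  -1, to which adding the cluster offset would be meaningless.\<close>

lemma is_succ_cluster:
  assumes "is_succ (cluster S b (x div b)) (x mod b) r" "x mod b < y" "y \<in> cluster S b (x div b)"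
  shows "is_succ S x (int (x div b * b) + r) \<and> 0 \<le> r"
proof -
  from assms obtain z where z: "z \<in> cluster S b (x div b)" "r = int z" "x mod b < z"
    "\<And>u. u \<in> cluster S b (x div b) \<Longrightarrow> x mod b < u \<Longrightarrow> z \<le> u"
    unfolding is_succ_def by fastforce
  have "x div b * b + z \<le> u" if "u \<in> S" "x < u" for u
  proof (cases "u div b = x div b")
    case True
    then have "u mod b \<in> cluster S b (x div b)"
      using that z(1) by (metis (mono_tags, lifting) div_mult_mod_eq mem_Collect_eq mod_less_divisor
        less_nat_zero_code not_gr_zero)
    moreover have "x mod b < u mod b"
      using that(2) True by (metis div_mult_mod_eq nat_add_left_cancel_less)
    ultimately have "z \<le> u mod b" using z(4) by blast
    then show ?thesis
      using True by (metis add_left_mono div_mult_mod_eq)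
  next
    case False
    then have "x div b < u div b"
      using div_le_mono[of x u b] that(2) by linarith
    then have "(x div b + 1) * b \<le> u div b * b" by (intro mult_le_mono1) simp
    also have "\<dots> \<le> u" by (rule div_times_less_eq_dividend)
    finally show ?thesis using z(1) by simp
  qed
  moreover have "x < x div b * b + z"
    using z(3) by (metis div_mult_mod_eq nat_add_left_cancel_less)
  moreover have "int (x div b * b) + r = int (x div b * b + z)" using z(2) by simp
  ultimately have "is_succ S x (int (x div b * b) + r)"
    using z(1) by (simp only: mem_Collect_eq) (intro is_succI, auto)
  then show ?thesis using z(2) by simp
qed

text \<open>When the cluster of \<open>x\<close> has nothing beyond \<open>x\<close>, all larger
  elements have a strictly larger cluster index (\<open>above\<close>), so the successor is the
  least element of the next nonempty cluster.\<close>

lemma is_succ_summary: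
  assumes b: "0 < b" and none: "\<And>y. y \<in> cluster S b (x div b) \<Longrightarrow> y \<le> x mod b"
    and r: "is_succ ((\<lambda>y. y div b) ` S) (x div b) r"
  shows "(r = -1 \<and> is_succ S x (-1)) \<or>
    (\<exists>i. r = int i \<and> cluster S b i \<noteq> {} \<and> is_succ S x (int (i * b + Min (cluster S b i))))"
proof -
  have above: "x div b < u div b" if "u \<in> S" "x < u" for u
  proof -
    have "u div b \<noteq> x div b"
    proof
      assume eq: "u div b = x div b"
      then have "u mod b \<in> cluster S b (x div b)"
        using that b by (metis (mono_tags, lifting) div_mult_mod_eq mem_Collect_eq mod_less_divisor)
      then have "u mod b \<le> x mod b" using none by blast
      then have "u \<le> x" using eq by (metis add_left_mono div_mult_mod_eq)
      with that show False by simp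
    qed
    moreover have "x div b \<le> u div b" using that by (simp add: div_le_mono)
    ultimately show ?thesis by simp
  qed
  consider "r = -1" "\<forall>u\<in>S. u div b \<le> x div b"
    | v where "v \<in> S" "r = int (v div b)" "x div b < v div b"
        "\<And>u. u \<in> S \<Longrightarrow> x div b < u div b \<Longrightarrow> v div b \<le> u div b"
    using r unfolding is_succ_def by (auto 0 4)
  then show ?thesis
  proof cases
    case 1
    then show ?thesis
      using above unfolding is_succ_def by (meson not_le)
  next
    case 2
    define i where "i = v div b"
    have fin: "finite (cluster S b i)" by simp
    have "v mod b \<in> cluster S b i" using 2(1) b by (simp add: i_def)
    then have ne: "cluster S b i \<noteq> {}" by blast
    define u where "u = i * b + Min (cluster S b i)"
    have mem: "Min (cluster S b i) \<in> cluster S b i" using Min_in[OF fin ne] .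
    then have "u \<in> S" by (simp add: u_def)
    have "u div b = i" using mem by (simp add: u_def)
    have "x < u"
      using \<open>u div b = i\<close> 2(3) i_def by (metis div_le_mono linorder_not_less)
    have "u \<le> z" if z: "z \<in> S" "x < z" for z
    proof -
      have "i \<le> z div b" using above[OF z] 2(4)[OF z(1)] i_def by simp
      show ?thesis
      proof (cases "z div b = i")
        case True
        then have "z mod b \<in> cluster S b i" using z(1) b
          by (metis (mono_tags, lifting) div_mult_mod_eq mem_Collect_eq mod_less_divisor)
        then have "Min (cluster S b i) \<le> z mod b" using fin by simp
        then show ?thesis unfolding u_def using True by (metis add_left_mono div_mult_mod_eq)
      next
        case False
        then have "(i + 1) * b \<le> z div b * b" using \<open>i \<le> z div b\<close> by (intro mult_le_mono1) simp
        also have "\<dots> \<le> z" by (rule div_times_less_eq_dividend)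
        finally show ?thesis using mem by (simp add: u_def)
      qed
    qed
    then have "is_succ S x (int u)" using \<open>u \<in> S\<close> \<open>x < u\<close> by (intro is_succI)
    then show ?thesis using ne 2(2) unfolding u_def i_def by blast
  qed
qed

text \<open>Needed because the minimum of a node is stored in none of its clusters, so the recursive
  searches only see the remaining elements.\<close>

lemma is_succ_remove_Min:
  assumes "finite S" "S = {} \<or> Min S \<le> x"
  shows "is_succ (S - {Min S}) x r \<longleftrightarrow> is_succ S x r"
  using assms unfolding is_succ_def
  by (smt (verit, best) Diff_iff insertE insertI1 empty_iff not_le)

section \<open>Correctness and cost of the successor search\<close>

context
  fixes W :: int and \<Pi> :: program and M :: mem and f :: int
  assumes \<Pi>: "1 < length \<Pi>" "\<Pi> ! 1 = succ_proc"
    and M: "\<And>a. 0 \<le> a \<Longrightarrow> a < f \<Longrightarrow> \<bar>M a\<bar> \<le> W" and W: "f \<le> W"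
begin

lemma wp_proc_succ_base:
  assumes "veb_at M f k a S" "x < 2 ^ k" "2 ^ k \<le> W" "k \<le> 1"
  shows "wp_proc W \<Pi> 1 [a, int x] M (\<lambda>r M' w d R X.
      is_succ S x r \<and> M' = M \<and> w \<le> 300 \<and> d \<le> 300 \<and> R \<subseteq> {..<f} \<and> X = {})"
proof -
  have k2: "k = 0 \<or> k = 1" using assms(4) by auto
  have v: "S \<subseteq> {..<2 ^ k}" "0 \<le> a" "a + 5 \<le> f" "M a = int k"
    "M (a + 2) = (if S = {} then -1 else int (Max S))"
    using assms(1) by (subst (asm) veb_at.simps, simp)+
  have fin: "finite S" using v(1) finite_subset by blast
  have "int x < 2 ^ k" using assms(2) by (metis of_nat_less_iff of_nat_numeral of_nat_power)
  then have xW: "int x \<le> W" using assms(3) by linarith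
  have fit: "\<bar>a\<bar> \<le> W" "\<bar>a + 2\<bar> \<le> W" "\<bar>M (a + 2)\<bar> \<le> W" "int k \<le> W" "int x \<le> W" "2 \<le> W"
    using v(2-4) W M[of a] xW by (auto intro!: M)
  have s1: "is_succ S x (M (a + 2))" if "int x < M (a + 2)"
  proof -
    have S: "S \<noteq> {}" "x < Max S" using that v(5) by (auto split: if_splits)
    have "Max S \<in> S" using S fin by simp
    then have "Max S < 2 ^ k" using v by auto
    then have "x = 0" "Max S = 1" using S k2 by auto
    then show ?thesis unfolding is_succ_def using S v(5) \<open>Max S \<in> S\<close> by auto
  qed
  have s2: "is_succ S x (- 1)" if "\<not> int x < M (a + 2)"
  proof (cases "S = {}")
    case False
    then have "y \<le> x" if "y \<in> S" for y
      using \<open>\<not> int x < M (a + 2)\<close> v(5) Max_ge[OF fin that] by simp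
    then show ?thesis unfolding is_succ_def by simp
  qed (simp add: is_succ_def)
  show ?thesis
    using \<Pi> assms(4) fit v(4) v(2,3) s1 s2
    by (simp add: wp_proc_def succ_proc_def)
qed

text \<open>The exponent \<open>j\<close> measures the number of key bits on a logarithmic scale:
  \<open>k <= 2 ^ Suc j\<close> gives \<open>(k + 1) div 2 <= 2 ^ j\<close>, also for the summary,
  which gets the rounded-up half. The 300 per level generously bounds the straight-line
  code.\<close>

lemma wp_proc_succ:
  "veb_at M f k a S \<Longrightarrow> x < 2 ^ k \<Longrightarrow> 2 ^ k \<le> W \<Longrightarrow> k \<le> 2 ^ j \<Longrightarrow>
    wp_proc W \<Pi> 1 [a, int x] M (\<lambda>r M' w d R X.
      is_succ S x r \<and> M' = M \<and> w \<le> 300 * (j + 1) \<and> d \<le> 300 * (j + 1) \<and> R \<subseteq> {..<f} \<and> X = {})"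
proof (induction j arbitrary: k a S x)
  case 0
  then show ?case using wp_proc_succ_base[of k a S x] by simp
next
  case (Suc j)
  show ?case
  proof (cases "k \<le> 1")
    case True
    show ?thesis
      by (rule wp_proc_mono[OF wp_proc_succ_base[OF Suc.prems(1-3) True]]) simp
  next
    case False
    define m where "m = k div 2"
    define m' where "m' = (k + 1) div 2"
    define h where "h = x div 2 ^ m"
    define l where "l = x mod 2 ^ m"
    define T where "T = S - {Min S}"
    define sm where "sm = M (a + 3)"
    define cs where "cs = M (a + 4)"
    define c where "c i = M (cs + int i)" for i :: nat
    have kk: "k = m + m'" "m' \<le> 2 ^ j" "m \<le> 2 ^ j" "m \<le> k" "m' \<le> k"
      using Suc.prems(4) by (auto simp: m_def m'_def)
    have v: "S \<subseteq> {..<2 ^ k}" "0 \<le> a" "a + 5 \<le> f" "M a = int k"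
      "M (a + 1) = (if S = {} then -1 else int (Min S))"
      "veb_at M f m' sm ((\<lambda>y. y div 2 ^ m) ` T)"
      "0 \<le> cs" "cs + 2 ^ m' \<le> f"
      "\<And>i. i < 2 ^ m' \<Longrightarrow> veb_at M f m (c i) (cluster T (2 ^ m) i)"
      using Suc.prems(1) False unfolding m_def m'_def T_def sm_def cs_def c_def
      by (subst (asm) veb_at.simps, simp)+
    have fin: "finite S" using v(1) finite_subset by blast
    have leW: "int i \<le> W" if "i \<le> 2 ^ k" for i :: nat
      using of_nat_mono[OF that, where 'a = int] Suc.prems(3) by (simp only: of_nat_power of_nat_numeral)
    have fit0: "1 \<le> W" using leW[of 1] by simp
    have pow: "(2 :: int) ^ m \<le> 2 ^ k" "(2 :: int) ^ m' \<le> 2 ^ k"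
      using kk(4,5) by (auto intro: power_increasing)
    have succW: "\<bar>r\<bar> \<le> W" if "is_succ S x r" for r
    proof -
      have "r = -1 \<or> (\<exists>y\<in>S. r = int y)" using that unfolding is_succ_def by auto
      then show ?thesis
      proof
        assume "\<exists>y\<in>S. r = int y"
        then obtain y where "r = int y" "y < 2 ^ k" using v(1) by auto
        then show ?thesis using leW[of y] by simp
      qed (use fit0 in simp)
    qed
    have x: "int x \<le> W" using Suc.prems(2) leW by simp
    have fit: "\<bar>a\<bar> \<le> W" "\<bar>a + 1\<bar> \<le> W" "\<bar>a + 3\<bar> \<le> W" "\<bar>a + 4\<bar> \<le> W" "\<bar>M (a + 1)\<bar> \<le> W"
      "\<bar>sm\<bar> \<le> W" "\<bar>cs\<bar> \<le> W" "int k \<le> W" "4 \<le> W"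
      using v(2-4) W M[of a] x unfolding sm_def cs_def by (auto intro!: M)
    show ?thesis
    proof (cases "int x < M (a + 1)")
      case True
      then have "S \<noteq> {}" "x < Min S" using v(5) by (auto split: if_splits)
      then have "is_succ S x (M (a + 1))"
        using v(5) fin unfolding is_succ_def by auto
      then show ?thesis using \<Pi> False fit x True v(2,3,4)
        by (simp add: wp_proc_def succ_proc_def)
    next
      case False2: False
      have minx: "S = {} \<or> Min S \<le> x" using False2 v(5) by (auto split: if_splits)
      have succT: "is_succ T x r \<longleftrightarrow> is_succ S x r" for r
        unfolding T_def using is_succ_remove_Min[OF fin minx] .
      have cfit: "\<bar>c i\<bar> \<le> W" "\<bar>cs + int i\<bar> \<le> W" "cs + int i < f" "0 \<le> c i"
         "c i + 5 \<le> f" "\<bar>c i + 1\<bar> \<le> W" "\<bar>c i + 2\<bar> \<le> W" "\<bar>M (c i + 1)\<bar> \<le> W" "\<bar>M (c i + 2)\<bar> \<le> W"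
         if "i < 2 ^ m'" for i
      proof -
        have "int i < 2 ^ m'" using that by (metis of_nat_less_iff of_nat_numeral of_nat_power)
        then have "cs + int i < f" using v(8) by linarith
        moreover have "0 \<le> c i \<and> c i + 5 \<le> f"
          using v(9)[OF that] by (subst (asm) veb_at.simps, simp)
        ultimately show "\<bar>c i\<bar> \<le> W" "\<bar>cs + int i\<bar> \<le> W" "cs + int i < f" "0 \<le> c i"
         "c i + 5 \<le> f" "\<bar>c i + 1\<bar> \<le> W" "\<bar>c i + 2\<bar> \<le> W" "\<bar>M (c i + 1)\<bar> \<le> W" "\<bar>M (c i + 2)\<bar> \<le> W"
          using v(7) W by (auto intro!: M)
      qed
      have h: "h < 2 ^ m'" using Suc.prems(2) unfolding h_def kk(1)
        by (simp add: less_mult_imp_div_less power_add mult.commute)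
      have l: "l < 2 ^ m" unfolding l_def by simp
      have xhl: "x = h * 2 ^ m + l" unfolding h_def l_def by (rule div_mult_mod_eq[symmetric])
      define hb where "hb = int h * 2 ^ m"
      have hb: "hb = int (h * 2 ^ m)" unfolding hb_def by simp
      have hx: "0 \<le> hb" "hb \<le> W" "int h \<le> W" "int l \<le> W" "int m \<le> W"
      proof -
        show "0 \<le> hb" "hb \<le> W" using xhl x unfolding hb by linarith+
        show "int l \<le> W" using xhl x by linarith
        have "h \<le> x" unfolding h_def by simp
        then show "int h \<le> W" using x by linarith
        show "int m \<le> W" using kk(4) fit(8) by linarith
      qed
      have ops: "int k div 2 = int m" "int x div 2 ^ m = int h" "int h * 2 ^ m = hb" "int x - hb = int l"
        by (simp add: m_def zdiv_int, simp add: h_def zdiv_int, simp add: hb_def,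
            use xhl hb in linarith)
      have maxc: "M (c h + 2) = (if cluster T (2 ^ m) h = {} then -1 else int (Max (cluster T (2 ^ m) h)))"
        using v(9)[OF h] by (subst (asm) veb_at.simps, simp)
      show ?thesis
      proof (cases "int l < M (c h + 2)")
        case True
        then have ne: "cluster T (2 ^ m) h \<noteq> {}" and lt: "l < Max (cluster T (2 ^ m) h)"
          unfolding maxc by (auto simp only: split: if_splits)
        define y where "y = Max (cluster T (2 ^ m) h)"
        have y: "y \<in> cluster T (2 ^ m) h" "l < y"
          unfolding y_def by (rule Max_in[OF _ ne], simp) (rule lt)
        have IH: "wp_proc W \<Pi> 1 [c h, int l] M (\<lambda>r M' w d R X.
          is_succ (cluster T (2 ^ m) h) l r \<and> M' = M \<and> w \<le> 300 * (j + 1) \<and> d \<le> 300 * (j + 1) \<and>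
          R \<subseteq> {..<f} \<and> X = {})"
          by (rule Suc.IH[OF v(9)[OF h] l _ kk(3)]) (use Suc.prems(3) pow in linarith)
        have post: "is_succ S x (hb + r)" "\<bar>hb + r\<bar> \<le> W" "\<bar>r\<bar> \<le> W"
          if "is_succ (cluster T (2 ^ m) h) l r" for r
        proof -
          have *: "is_succ T x (hb + r) \<and> 0 \<le> r"
            using is_succ_cluster[where S = T and b = "2 ^ m" and x = x and r = r and y = y] that y unfolding hb h_def l_def by blast
          then show "is_succ S x (hb + r)" using succT by simp
          then show "\<bar>hb + r\<bar> \<le> W" using succW by blast
          then show "\<bar>r\<bar> \<le> W" using * hx(1) by linarith
        qed
        show ?thesis
          using \<Pi> False False2 True v(2-4,7) fit cfit[OF h] hx x
          by (simp add: wp_proc_def[of _ _ _ "[a, int x]"] succ_proc_def ops args_cost_def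
              flip: c_def cs_def sm_def)
            (rule wp_proc_mono[OF IH[unfolded One_nat_def]], auto simp: post)
      next
        case False3: False
        have none: "y \<le> l" if "y \<in> cluster T (2 ^ m) h" for y
        proof -
          have "y \<le> Max (cluster T (2 ^ m) h)" by (rule Max_ge[OF _ that]) simp
          moreover have "cluster T (2 ^ m) h \<noteq> {}" using that by blast
          ultimately show ?thesis using False3 unfolding maxc by (simp only: if_False not_less of_nat_le_iff of_nat_less_iff)
        qed
        have IH: "wp_proc W \<Pi> 1 [sm, int h] M (\<lambda>r M' w d R X.
          is_succ ((\<lambda>y. y div 2 ^ m) ` T) h r \<and> M' = M \<and> w \<le> 300 * (j + 1) \<and> d \<le> 300 * (j + 1) \<and>
          R \<subseteq> {..<f} \<and> X = {})"
          by (rule Suc.IH[OF v(6) h _ kk(2)]) (use Suc.prems(3) pow in linarith)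
        have post: "(r = -1 \<and> is_succ S x (-1)) \<or>
            (\<exists>i<2 ^ m'. r = int i \<and> int i \<le> W \<and> int i * 2 ^ m \<le> W \<and>
                is_succ S x (int i * 2 ^ m + M (c i + 1)) \<and> \<bar>int i * 2 ^ m + M (c i + 1)\<bar> \<le> W \<and>
                0 \<le> cs + int i \<and> cs + int i \<le> W \<and> cs + int i < f \<and> 0 \<le> c i \<and> c i + 5 \<le> f \<and>
                c i \<le> W \<and> c i + 1 \<le> W \<and> \<bar>M (c i + 1)\<bar> \<le> W)"
          if r: "is_succ ((\<lambda>y. y div 2 ^ m) ` T) h r" for r
        proof -
          have "(r = -1 \<and> is_succ T x (-1)) \<or> (\<exists>i. r = int i \<and> cluster T (2 ^ m) i \<noteq> {} \<and>
              is_succ T x (int (i * 2 ^ m + Min (cluster T (2 ^ m) i))))"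
            by (rule is_succ_summary) (use none r in \<open>simp_all add: h_def l_def\<close>)
          then show ?thesis
          proof (elim disjE exE conjE)
            fix i assume i: "r = int i" "cluster T (2 ^ m) i \<noteq> {}"
              and u: "is_succ T x (int (i * 2 ^ m + Min (cluster T (2 ^ m) i)))"
            \<comment> \<open>The index delivered by the summary belongs to an actual key below
              \<open>2 ^ k\<close>, so it is a legitimate position in the cluster array.\<close>
            from i(2) obtain y where "i * 2 ^ m + y \<in> T" "y < 2 ^ m" by blast
            then have yk: "i * 2 ^ m + y < 2 ^ k" using v(1) by (auto simp: T_def)
            have "i * 2 ^ m + y < 2 ^ m' * 2 ^ m"
              using yk unfolding kk(1) by (simp only: power_add mult.commute)
            then have "i * 2 ^ m < 2 ^ m' * 2 ^ m" by linarith
            then have im: "i < 2 ^ m'" by (simp only: mult_less_cancel2)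
            have min: "M (c i + 1) = int (Min (cluster T (2 ^ m) i))"
              using v(9)[OF im] i(2) by (subst (asm) veb_at.simps) (simp only: if_False)
            have "int (i * 2 ^ m) \<le> W" using yk by (intro leW) simp
            moreover have "i \<le> i * 2 ^ m" by simp
            then have "int i \<le> W" using yk by (intro leW) linarith
            moreover have "is_succ S x (int i * 2 ^ m + M (c i + 1))"
              using u succT unfolding min by simp
            ultimately show ?thesis using \<open>int i \<le> W\<close> i(1) im succW[of "int i * 2 ^ m + M (c i + 1)"]
                cfit[OF im] v(7) by auto
          qed (use succT in auto)
        qed
        show ?thesis
          using \<Pi> False False2 False3 v(2-4,7) fit cfit[OF h] hx x
          by (simp add: wp_proc_def[of _ _ _ "[a, int x]"] succ_proc_def ops args_cost_def
              flip: c_def cs_def sm_def)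
            (rule wp_proc_mono[OF IH[unfolded One_nat_def]], auto dest!: post simp flip: c_def)
      qed
    qed
  qed
qed

end

section \<open>Covered keys between two batch points\<close>

text \<open>
  A node has four words: the number of keys below it, the two children, and its own key (\<open>-1\<close> if
  it has none); keys are listed in preorder.  The address \<open>f\<close>, which holds \<open>0\<close>, serves as the empty
  tree everywhere.  Nodes are placed by content, for key \<open>y\<close> at \<open>g + 5 * y\<close> and for a batch split
  at \<open>m\<close> at \<open>f + 5 * m\<close> (whose fifth word keeps the maximum of the left half), so that parallel
  branches allocate memory without communicating.  The set \<open>A\<close> contains all words of the tree.
\<close>

inductive tree ::
  "mem \<Rightarrow> int \<Rightarrow> int set \<Rightarrow> int \<Rightarrow> nat list \<Rightarrow> nat \<Rightarrow> nat \<Rightarrow> bool"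
  for M f A where
  Leaf: "M f = 0 \<Longrightarrow> f \<in> A \<Longrightarrow> tree M f A f [] 0 0"
| Node: "tree M f A p1 xs1 n1 h1 \<Longrightarrow> tree M f A p2 xs2 n2 h2 \<Longrightarrow> {p..<p + 4} \<subseteq> A \<Longrightarrow>
    M p = int (length (own @ xs1 @ xs2)) \<Longrightarrow> M (p + 1) = p1 \<Longrightarrow> M (p + 2) = p2 \<Longrightarrow>
    own = [] \<and> M (p + 3) = -1 \<or> (\<exists>x. own = [x] \<and> M (p + 3) = int x) \<Longrightarrow>
    tree M f A p (own @ xs1 @ xs2) (n1 + n2 + 1) (max h1 h2 + 1)"

text \<open>The reason for carrying the footprint \<open>A\<close>: after a fork, each branch's tree
  survives because the sibling writes elsewhere, and both footprints can be enlarged to a common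
  one.\<close>

lemma tree_mono:
  assumes "tree M f A p xs n h" "\<And>a. a \<in> A \<Longrightarrow> M' a = M a" "A \<subseteq> A'"
  shows "tree M' f A' p xs n h"
  using assms(1)
proof induction
  case Leaf
  then show ?case using assms(2,3) by (auto intro: tree.Leaf)
next
  case (Node p1 xs1 n1 h1 p2 xs2 n2 h2 p own)
  have "{p, p + 1, p + 2, p + 3} \<subseteq> A" using Node.hyps(3) by auto
  then have "M' p = M p" "M' (p + 1) = M (p + 1)" "M' (p + 2) = M (p + 2)" "M' (p + 3) = M (p + 3)"
    using assms(2) by auto
  then show ?case using Node assms(3) by (intro tree.Node) auto
qed

lemma tree_root:
  assumes "tree M f A p xs n h"
  shows "p \<in> A" "M p = int (length xs)"
  using assms by (cases; auto)+

definition join_code :: "int \<Rightarrow> exp \<Rightarrow> com" where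
  "join_code c e = seqs [
     Load 12 (Reg 10),
     Load 13 (Reg 11),
     Store (Reg 0) (Op Add (Const c) (Op Add (Reg 12) (Reg 13))),
     Store (Op Add (Reg 0) (Const 1)) (Reg 10),
     Store (Op Add (Reg 0) (Const 2)) (Reg 11),
     Store (Op Add (Reg 0) (Const 3)) e]"

text \<open>The four stores miss both footprints, so the subtrees persist. Key nodes use it with
  \<open>c = 1\<close> and batch splits with \<open>c = 0\<close> and key -1. The condition on
  \<open>e\<close> ranges over registers 12 and 13 because these are overwritten before
  \<open>e\<close> is evaluated.\<close>

lemma wp_join:
  assumes t1: "tree M f A1 r1 xs1 n1 h1" and t2: "tree M f A2 r2 xs2 n2 h2"
    and s: "s 0 = p" "s 10 = r1" "s 11 = r2"
    and A: "A1 \<union> A2 \<subseteq> {0..W}" "{p..<p + 4} \<inter> (A1 \<union> A2) = {}"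
    and p: "0 \<le> p" "p + 3 \<le> W"
    and len: "int (length (own @ xs1 @ xs2)) \<le> W"
    and e: "\<And>a b. fits W e (s(12 := a, 13 := b))" "\<And>a b. val e (s(12 := a, 13 := b)) = y"
      "exp_cost e = 1"
    and own: "own = [] \<and> y = -1 \<or> (\<exists>x. own = [x] \<and> y = int x)"
    and c: "c = int (length own)"
  shows "wp W \<Pi> (join_code c e) s M (\<lambda>s' M' w d R X.
     s' 0 = p \<and>
     tree M' f ({p..<p + 4} \<union> A1 \<union> A2) p (own @ xs1 @ xs2) (n1 + n2 + 1) (max h1 h2 + 1) \<and>
     w \<le> 60 \<and> d \<le> 60 \<and> R \<subseteq> A1 \<union> A2 \<and> X \<subseteq> {p..<p + 4})"
proof -
  define M' where "M' = M(p := int (length (own @ xs1 @ xs2)), p + 1 := r1, p + 2 := r2, p + 3 := y)"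
  note r1 = tree_root[OF t1] and r2 = tree_root[OF t2]
  have same: "M' a = M a" if "a \<in> A1 \<union> A2" for a
  proof -
    have "a \<notin> {p..<p + 4}" using A(2) that by blast
    then show ?thesis unfolding M'_def by auto
  qed
  have T1: "tree M' f ({p..<p + 4} \<union> A1 \<union> A2) r1 xs1 n1 h1"
    using same by (intro tree_mono[OF t1]) auto
  have T2: "tree M' f ({p..<p + 4} \<union> A1 \<union> A2) r2 xs2 n2 h2"
    using same by (intro tree_mono[OF t2]) auto
  have T: "tree M' f ({p..<p + 4} \<union> A1 \<union> A2) p (own @ xs1 @ xs2) (n1 + n2 + 1) (max h1 h2 + 1)"
    using own by (intro tree.Node[OF T1 T2]) (auto simp: M'_def)
  have "r1 \<in> {0..W}" "r2 \<in> {0..W}" using r1(1) r2(1) A(1) by blast+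
  then show ?thesis
    using r1 r2 p len e own T A(1) s unfolding M'_def
    by (simp add: c join_code_def add.commute add.left_commute)
qed

section \<open>Enumerating the covered keys of one interval\<close>

definition key_build :: com where
  "key_build = seqs [
     Assign 9 (Op Quot (Op Add (Reg 7) (Reg 1)) (Const 2)),
     Fork 10 2 [Reg 7, Reg 9, Reg 2, Reg 3, Reg 4, Reg 5, Reg 6]
          11 2 [Reg 9, Reg 1, Reg 2, Reg 3, Reg 4, Reg 5, Reg 6],
     Assign 0 (Op Add (Reg 5) (Op Mul (Const 5) (Reg 7))),
     join_code 1 (Reg 7)]"

definition key_test :: com where
  "key_test =
     Cond (Op Less (Reg 7) (Const 0)) (Assign 0 (Reg 6))
    (Cond (Op Less (Reg 1) (Reg 7)) (Assign 0 (Reg 6))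
    (Seq (Load 8 (Op Add (Op Add (Reg 4) (Op Mul (Const 2) (Reg 7))) (Const 1)))
    (Cond (Op Less (Reg 2) (Reg 8)) (Assign 0 (Reg 6))
      key_build)))"

definition key_proc :: com where
  "key_proc = Seq (Call 7 1 [Reg 3, Reg 0]) key_test"

locale mono_keys =
  fixes W :: int and \<Pi> :: program and M :: mem and f v t g :: int and k J U :: nat and S :: "nat set"
  assumes progs: "2 < length \<Pi>" "\<Pi> ! 1 = succ_proc" "\<Pi> ! 2 = key_proc"
    and M_le: "\<And>a. 0 \<le> a \<Longrightarrow> a < f \<Longrightarrow> \<bar>M a\<bar> \<le> W"
    and M_f: "M f = 0"
    and veb: "veb_at M f k v S"
    and k: "2 ^ k \<le> W" "U \<le> 2 ^ k" "k \<le> 2 ^ J"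
    and S: "S \<subseteq> {..<U}"
    and table: "0 \<le> t" "t + 2 * int U \<le> f"
    and scores: "\<And>x y. x \<in> S \<Longrightarrow> y \<in> S \<Longrightarrow> x < y \<Longrightarrow> M (t + 2 * int x + 1) < M (t + 2 * int y + 1)"
    and g: "f \<le> g" "g + 5 * int U + 2 \<le> W"
begin

definition score :: "nat \<Rightarrow> int" where "score x = M (t + 2 * int x + 1)"

text \<open>The slots of the keys in the interval open at \<open>lo\<close> and closed at
  \<open>hi\<close>. Splitting the interval splits this range exactly, so the halves cannot
  race.\<close>

definition key_region :: "int \<Rightarrow> int \<Rightarrow> int set" where
  "key_region lo hi = {g + 5 * (lo + 1)..<g + 5 * (hi + 1)}"

text \<open>Budget of one call without its children: \<open>300 * (J + 1)\<close> for the successor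
  query, 300 for everything else.\<close>

abbreviation Q :: nat where "Q \<equiv> 300 * (J + 1) + 300"

text \<open>The slack \<open>c\<close> is the cost that callers have yet to add.\<close>

definition key_post where
  "key_post c lo hi d j = (\<lambda>r M' w e R X. \<exists>xs h.
     tree M' f ({f} \<union> key_region lo hi) r xs (length xs) h \<and> h \<le> j \<and> sorted_wrt (<) xs \<and>
     set xs = {s \<in> S. lo < int s \<and> int s \<le> hi \<and> score s \<le> d} \<and>
     w + c \<le> (2 * length xs + 1) * Q \<and> e + c \<le> (j + 1) * Q \<and>
     R \<subseteq> {..f} \<union> key_region lo hi \<and> X \<subseteq> key_region lo hi)"

lemma key_post_mono:
  assumes "key_post c lo hi d j r M' w e R X"
    and "w' + c' \<le> w + c" "e' + c' \<le> e + c" "R' \<subseteq> {..f} \<union> R" "X' \<subseteq> X"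
  shows "key_post c' lo hi d j r M' w' e' R' X'"
proof -
  from assms(1) obtain xs h where
    "tree M' f ({f} \<union> key_region lo hi) r xs (length xs) h" "h \<le> j" "sorted_wrt (<) xs"
    "set xs = {s \<in> S. lo < int s \<and> int s \<le> hi \<and> score s \<le> d}"
    "w + c \<le> (2 * length xs + 1) * Q" "e + c \<le> (j + 1) * Q"
    "R \<subseteq> {..f} \<union> key_region lo hi" "X \<subseteq> key_region lo hi"
    unfolding key_post_def by blast
  with assms(2-5) show ?thesis
    unfolding key_post_def by (intro exI[of _ xs] exI[of _ h] conjI) (assumption | blast | linarith)+
qed

lemma key_post_Leaf:
  assumes "{s \<in> S. lo < int s \<and> int s \<le> hi \<and> score s \<le> d} = {}"
    and "w \<le> Q" "e \<le> Q" "R \<subseteq> {..f}"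
  shows "key_post 0 lo hi d j f M w e R {}"
  using assms tree.Leaf[of M f "{f} \<union> key_region lo hi"] M_f
  unfolding key_post_def by (intro exI[of _ "[]"] exI[of _ 0]) auto

text \<open>The count closes exactly: \<open>2 * length xs1 + 1\<close> and
  \<open>2 * length xs2 + 1\<close> units for the children and one unit here give
  \<open>2 * length xs + 1\<close>, since \<open>xs\<close> has one key more. Preorder is increasing
  because \<open>s\<close> is the least key still considered.\<close>

lemma wp_key_build:
  assumes IH: "\<And>lo hi. lo < U \<Longrightarrow> hi < int U \<Longrightarrow> -1 \<le> hi \<Longrightarrow> hi - int lo < 2 ^ j \<Longrightarrow>
      wp_proc W \<Pi> 2 [int lo, hi, d, v, t, g, f] M (key_post 0 (int lo) hi d j)"
    and s: "s \<in> S" "int s \<le> hi" "lo < s" "hi < int U" "hi - int lo < 2 ^ Suc j"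
    and regs: "\<sigma> 1 = hi" "\<sigma> 2 = d" "\<sigma> 3 = v" "\<sigma> 4 = t" "\<sigma> 5 = g" "\<sigma> 6 = f" "\<sigma> 7 = int s"
    and d: "\<bar>d\<bar> \<le> W" "score s \<le> d"
    and least: "\<And>z. z \<in> S \<Longrightarrow> lo < z \<Longrightarrow> s \<le> z"
  shows "wp W \<Pi> key_build \<sigma> M (\<lambda>\<sigma>'. key_post (300 * (J + 1) + 100) (int lo) hi d (Suc j) (\<sigma>' 0))"
proof -
  define mid where "mid = (s + nat hi) div 2"
  have hi: "0 \<le> hi" "s \<le> nat hi" using s(2) by linarith+
  have mid: "(int s + hi) div 2 = int mid" using hi(1) unfolding mid_def by (simp add: zdiv_int)
  have mid_le: "s \<le> mid" "int mid \<le> hi" "mid < U" "s < U"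
    using hi s(2,4) unfolding mid_def by linarith+
  have IH1: "wp_proc W \<Pi> 2 [int s, int mid, d, v, t, g, f] M (key_post 0 (int s) (int mid) d j)"
    by (rule IH) (use s(3,5) hi mid_le in \<open>auto simp: mid_def\<close>)
  \<comment> \<open>Here \<open>lo < s\<close> matters: it gives
    \<open>hi - int s <= 2 ^ Suc j - 2\<close>, so that even the rounded-up half stays strictly
    below \<open>2 ^ j\<close>.\<close>
  have IH2: "wp_proc W \<Pi> 2 [int mid, hi, d, v, t, g, f] M (key_post 0 (int mid) hi d j)"
    by (rule IH) (use s(3-5) hi mid_le in \<open>auto simp: mid_def\<close>)
  have v: "0 \<le> v" "v \<le> f" using veb by (subst (asm) veb_at.simps, simp)+
  have fits: "int s \<le> W" "int mid \<le> W" "\<bar>int s\<bar> \<le> W" "\<bar>hi\<bar> \<le> W" "\<bar>int s + hi\<bar> \<le> W" "2 \<le> W" "\<bar>int mid\<bar> \<le> W" "\<bar>d\<bar> \<le> W" "\<bar>v\<bar> \<le> W"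
    "\<bar>t\<bar> \<le> W" "\<bar>g\<bar> \<le> W" "\<bar>f\<bar> \<le> W" "\<bar>5 * int s\<bar> \<le> W" "\<bar>g + 5 * int s\<bar> \<le> W" "5 \<le> W"
    using s(2,4) hi d(1) mid_le v g table by linarith+
  define p where "p = g + 5 * int s"
  define D where "D lo hi = {z \<in> S. lo < int z \<and> int z \<le> hi \<and> score z \<le> d}" for lo hi
  have regions: "key_region (int s) (int mid) \<inter> key_region (int mid) hi = {}"
    "key_region (int s) (int mid) \<inter> {..f} = {}" "key_region (int mid) hi \<inter> {..f} = {}"
    "{p..<p + 4} \<inter> (({f} \<union> key_region (int s) (int mid)) \<union> ({f} \<union> key_region (int mid) hi)) = {}"
    "({f} \<union> key_region (int s) (int mid)) \<union> ({f} \<union> key_region (int mid) hi) \<subseteq> {0..W}"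
    "{p..<p + 4} \<subseteq> key_region (int lo) hi"
    "key_region (int s) (int mid) \<subseteq> key_region (int lo) hi"
    "key_region (int mid) hi \<subseteq> key_region (int lo) hi"
    using g table s(2-4) mid_le unfolding key_region_def p_def by auto
  have split: "D (int lo) hi = insert s (D (int s) (int mid) \<union> D (int mid) hi)"
    using s(1-3) d(2) mid_le least unfolding D_def by force
  have card: "int (length xs) \<le> W" if "set xs \<subseteq> S" "sorted_wrt (<) xs" for xs :: "nat list"
  proof -
    have "length xs = card (set xs)" using that(2) by (simp add: strict_sorted_iff distinct_card)
    also have "\<dots> \<le> card {..<U}" using that(1) S by (intro card_mono) auto
    finally show ?thesis using g table by simp
  qed
  have join: "wp W \<Pi> (join_code 1 (Reg 7)) (\<sigma>(9 := int mid, 10 := r1, 11 := r2, 0 := p)) M'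
        (\<lambda>s2 M2 w e R X. key_post (400 + 300 * J) (int lo) hi d (Suc j) (s2 0) M2
          (c + w1 + w2 + w) (c + max e1 e2 + e) (R1 \<union> R2 \<union> R) (X1 \<union> X2 \<union> X))"
    if c: "c \<le> 100"
      and r1: "key_post 0 (int s) (int mid) d j r1 M1 w1 e1 R1 X1"
      and r2: "key_post 0 (int mid) hi d j r2 M2 w2 e2 R2 X2"
      and M1: "\<And>a. a \<notin> X2 \<Longrightarrow> M' a = M1 a" and M2: "\<And>a. a \<notin> X1 \<Longrightarrow> M' a = M2 a"
    for r1 r2 M1 M2 M' w1 w2 e1 e2 R1 R2 X1 X2 c
  proof -
    from r1 obtain xs1 h1 where 1: "tree M1 f ({f} \<union> key_region (int s) (int mid)) r1 xs1 (length xs1) h1"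
      "h1 \<le> j" "sorted_wrt (<) xs1" "set xs1 = D (int s) (int mid)"
      "w1 \<le> (2 * length xs1 + 1) * Q" "e1 \<le> (j + 1) * Q"
      "R1 \<subseteq> {..f} \<union> key_region (int s) (int mid)" "X1 \<subseteq> key_region (int s) (int mid)"
      unfolding key_post_def D_def by auto
    from r2 obtain xs2 h2 where 2: "tree M2 f ({f} \<union> key_region (int mid) hi) r2 xs2 (length xs2) h2"
      "h2 \<le> j" "sorted_wrt (<) xs2" "set xs2 = D (int mid) hi"
      "w2 \<le> (2 * length xs2 + 1) * Q" "e2 \<le> (j + 1) * Q"
      "R2 \<subseteq> {..f} \<union> key_region (int mid) hi" "X2 \<subseteq> key_region (int mid) hi"
      unfolding key_post_def D_def by auto
    have t1: "tree M' f ({f} \<union> key_region (int s) (int mid)) r1 xs1 (length xs1) h1"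
      by (rule tree_mono[OF 1(1) M1]) (use regions 2(8) in auto)
    have t2: "tree M' f ({f} \<union> key_region (int mid) hi) r2 xs2 (length xs2) h2"
      by (rule tree_mono[OF 2(1) M2]) (use regions 1(8) in auto)
    let ?xs = "[s] @ xs1 @ xs2"
    have sorted: "sorted_wrt (<) ?xs"
      using 1(3,4) 2(3,4) mid_le(1) by (fastforce simp: D_def sorted_wrt_append)
    have set: "set ?xs = D (int lo) hi" using split 1(4) 2(4) by simp
    then have len: "int (length ?xs) \<le> W" using card[OF _ sorted] unfolding D_def by auto
    let ?\<sigma> = "\<sigma>(9 := int mid, 10 := r1, 11 := r2, 0 := p)"
    show ?thesis
    proof (rule wp_mono[OF wp_join[where y = "int s" and own = "[s]", OF t1 t2 _ _ _ regions(5,4)]],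
        goal_cases)
      case (12 s' M2' w e R X)
      then have *: "s' 0 = p"
        "tree M2' f ({p..<p + 4} \<union> ({f} \<union> key_region (int s) (int mid)) \<union>
           ({f} \<union> key_region (int mid) hi)) p ?xs (length xs1 + length xs2 + 1) (max h1 h2 + 1)"
        "w \<le> 60" "e \<le> 60" "R \<subseteq> insert f (key_region (int s) (int mid) \<union> key_region (int mid) hi)"
        "X \<subseteq> {p..<p + 4}" by auto
      have "tree M2' f ({f} \<union> key_region (int lo) hi) p ?xs (length ?xs) (max h1 h2 + 1)"
        using tree_mono[OF *(2), of M2' "{f} \<union> key_region (int lo) hi"] regions(6-8) by auto
      moreover have "c + w1 + w2 + w + (400 + 300 * J) \<le> (2 * length ?xs + 1) * Q"
      proof -
        \<comment> \<open>With the children's bounds abstracted as \<open>A\<close> and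
          \<open>B\<close>, it remains to see that \<open>100 + 60 + 400 + 300 * J\<close> fits into
          one \<open>Q\<close>.\<close>
        have "c + w1 + w2 + w + (400 + 300 * J) \<le> A + B + Q" if "w1 \<le> A" "w2 \<le> B" for A B
          using that c *(3) by simp
        from this[OF 1(5) 2(5)]
        have "c + w1 + w2 + w + (400 + 300 * J) \<le> (2 * length xs1 + 1) * Q + (2 * length xs2 + 1) * Q + Q" .
        also have "\<dots> = (2 * length ?xs + 1) * Q"
          by (simp add: algebra_simps)
        finally show ?thesis .
      qed
      moreover have "c + max e1 e2 + e + (400 + 300 * J) \<le> (Suc j + 1) * Q"
      proof -
        have "c + max e1 e2 + e + (400 + 300 * J) \<le> A + Q" if "e1 \<le> A" "e2 \<le> A" for A
          using that c *(4) by simp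
        from this[OF 1(6) 2(6)]
        have "c + max e1 e2 + e + (400 + 300 * J) \<le> (j + 1) * Q + Q" .
        then show ?thesis by simp
      qed
      moreover have "R1 \<union> R2 \<union> R \<subseteq> {..f} \<union> key_region (int lo) hi" "X1 \<union> X2 \<union> X \<subseteq> key_region (int lo) hi"
        using 1(7,8) 2(7,8) *(5,6) regions(6-8) by blast+
      ultimately show ?case
        unfolding key_post_def *(1) using sorted set 1(2) 2(2) unfolding D_def
        by (intro exI[of _ ?xs] exI[of _ "max h1 h2 + 1"]) auto
    qed (use len fits regs(7) g table mid_le(4) in \<open>auto simp: p_def\<close>)
  qed
  have race: "X1 \<inter> (R2 \<union> X2) = {} \<and> X2 \<inter> (R1 \<union> X1) = {}"
    if "key_post 0 (int s) (int mid) d j r1 M1 w1 e1 R1 X1" "key_post 0 (int mid) hi d j r2 M2 w2 e2 R2 X2"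
    for r1 r2 M1 M2 w1 w2 e1 e2 R1 R2 X1 X2
    using that regions(1-3) unfolding key_post_def by blast
  show ?thesis
    apply (simp add: key_build_def regs regs(1)[unfolded One_nat_def] mid fits)
    apply (rule wp_Fork[OF _ _ IH1 _ IH2])
       apply (simp_all add: regs regs(1)[unfolded One_nat_def] mid fits)
     apply (erule (1) race)
    subgoal premises prems
      apply (rule conjI)
      subgoal using fits by simp
      \<comment> \<open>27 is the midpoint (6), the fork with its fourteen arguments (15) and the
        address of the new node (6).\<close>
      apply (rule wp_mono[OF join[unfolded p_def, where c = 27, OF _ prems]])
         apply simp
        apply assumption
       apply assumption
      apply (erule key_post_mono)
      apply (simp_all add: args_cost_def)
      done
    done
qed

lemma wp_key_test:
  assumes IH: "\<And>j' lo hi. j = Suc j' \<Longrightarrow> lo < U \<Longrightarrow> hi < int U \<Longrightarrow> -1 \<le> hi \<Longrightarrow> hi - int lo < 2 ^ j' \<Longrightarrow>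
      wp_proc W \<Pi> 2 [int lo, hi, d, v, t, g, f] M (key_post 0 (int lo) hi d j')"
    and r: "is_succ S lo r"
    and b: "-1 \<le> hi" "hi < int U" "hi - int lo < 2 ^ j" "\<bar>d\<bar> \<le> W"
    and regs: "\<sigma> 1 = hi" "\<sigma> 2 = d" "\<sigma> 3 = v" "\<sigma> 4 = t" "\<sigma> 5 = g" "\<sigma> 6 = f" "\<sigma> 7 = r"
  shows "wp W \<Pi> key_test \<sigma> M (\<lambda>\<sigma>'. key_post (300 * (J + 1) + 20) (int lo) hi d (j) (\<sigma>' 0))"
proof -
  have v: "0 \<le> v" "v \<le> f" using veb by (subst (asm) veb_at.simps, simp)+
  note regs' = regs regs(1)[unfolded One_nat_def]
  have leaf: "key_post (320 + 300 * J) (int lo) hi d (j) f M w e R {}"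
    if "\<And>z. z \<in> S \<Longrightarrow> lo < z \<Longrightarrow> int z \<le> hi \<Longrightarrow> \<not> score z \<le> d"
      "w \<le> 200" "e \<le> 200" "R \<subseteq> {..f}" for w e R
    by (rule key_post_mono[OF key_post_Leaf, of _ _ _ "w + (320 + 300 * J)" "e + (320 + 300 * J)" R])
      (use that in auto)
  from r consider "r = -1" "\<And>z. z \<in> S \<Longrightarrow> z \<le> lo"
    | s where "r = int s" "s \<in> S" "lo < s" "\<And>z. z \<in> S \<Longrightarrow> lo < z \<Longrightarrow> s \<le> z"
    unfolding is_succ_def by blast
  then show ?thesis
  proof cases
    case 1
    then show ?thesis
      using v g table by (simp add: key_test_def regs') (rule leaf, fastforce+)
  next
    case 2
    have sU: "s < U" using 2(2) S by blast
    have fits: "int s \<le> W" "hi \<le> W" "\<bar>hi\<bar> \<le> W" "2 * int s \<le> W" "\<bar>t\<bar> \<le> W" "\<bar>d\<bar> \<le> W" "\<bar>f\<bar> \<le> W" "t + 2 * int s \<le> W"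
      "t + 2 * int s + 1 \<le> W" "\<bar>t + 2 * int s\<bar> \<le> W" "\<bar>t + 2 * int s + 1\<bar> \<le> W" "1 \<le> W" "2 \<le> W" "t + 2 * int s + 1 \<le> f"
      "0 \<le> W"
      using v g table sU b by linarith+
    have score: "\<bar>score s\<bar> \<le> W" using table sU unfolding score_def by (intro M_le) auto
    note sc = score_def[symmetric]
    consider "hi < int s" | "int s \<le> hi" "d < score s" | "int s \<le> hi" "score s \<le> d" by linarith
    then show ?thesis
    proof cases
      case 1
      then show ?thesis using 2 fits
        by (fastforce simp: key_test_def regs' intro!: leaf)
    next
      case 3: 2
      have "\<not> score z \<le> d" if "z \<in> S" "lo < z" for z
        using scores[OF 2(2) that(1)] 2(4)[OF that] 3(2) unfolding score_def by (cases "z = s") auto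
      then show ?thesis using 3 2(1) fits score
        by (auto simp: key_test_def regs' sc intro!: leaf)
    next
      case 4: 3
      \<comment> \<open>A reported key lies in the interval, so \<open>j\<close> is not 0; hence the
        induction hypothesis is only required for a predecessor of \<open>j\<close>.\<close>
      have "2 ^ j > (1 :: int)" using 4 2 b by linarith
      then obtain j' where j': "j = Suc j'" by (cases j) auto
      have "wp W \<Pi> key_build (\<sigma>(8 := score s)) M
         (\<lambda>\<sigma>'. key_post (300 * (J + 1) + 100) (int lo) hi d (j) (\<sigma>' 0))"
        unfolding j' by (rule wp_key_build[OF IH[OF j']]) (use 2 4 b regs j' in auto)
      then show ?thesis using 4 2(1) fits score
        apply (simp add: key_test_def regs' sc)
        apply (erule wp_mono)
        apply (erule key_post_mono)
        apply simp_all
        done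
    qed
  qed
qed

lemma wp_proc_key:
  "lo < U \<Longrightarrow> hi < int U \<Longrightarrow> -1 \<le> hi \<Longrightarrow> hi - int lo < 2 ^ j \<Longrightarrow> \<bar>d\<bar> \<le> W \<Longrightarrow>
    wp_proc W \<Pi> 2 [int lo, hi, d, v, t, g, f] M (key_post 0 (int lo) hi d j)"
proof (induction j arbitrary: lo hi rule: less_induct)
  case (less j)
  have v: "0 \<le> v" "v \<le> f" using veb by (subst (asm) veb_at.simps, simp)+
  have fits: "int lo \<le> W" "\<bar>v\<bar> \<le> W"
    using v g table less.prems by linarith+
  have succ: "wp_proc W \<Pi> 1 [v, int lo] M (\<lambda>r M' w d R X.
      is_succ S lo r \<and> M' = M \<and> w \<le> 300 * (J + 1) \<and> d \<le> 300 * (J + 1) \<and> R \<subseteq> {..<f} \<and> X = {})"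
    by (rule wp_proc_succ[OF _ _ M_le _ veb]) (use progs k g table less.prems in auto)
  show ?case
    using progs fits less.prems
    apply (simp add: wp_proc_def[of _ _ 2] key_proc_def)
    apply (rule wp_proc_mono[OF succ[unfolded One_nat_def]])
    apply (elim conjE)
    apply hypsubst
    apply (rule wp_mono[OF wp_key_test[where j = j and lo = lo and hi = hi and d = d]])
              apply (rule less.IH)
                   apply (simp_all add: args_cost_def)
    apply (erule key_post_mono)
       apply auto
    done
qed

end

section \<open>Prefix maxima\<close>

text \<open>Only the upward half of a parallel scan. The downward half is fused with the batch
  recursion, which hands the maximum of everything to the left down to its calls.\<close>

definition scan_proc :: com where
  "scan_proc =
     Cond (Op Less (Op Sub (Reg 1) (Reg 0)) (Const 2))
       (Load 0 (Op Add (Op Add (Reg 2) (Op Mul (Const 3) (Reg 0))) (Const 2)))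
       (seqs [
         Assign 4 (Op Quot (Op Add (Reg 0) (Reg 1)) (Const 2)),
         Fork 5 3 [Reg 0, Reg 4, Reg 2, Reg 3] 6 3 [Reg 4, Reg 1, Reg 2, Reg 3],
         Store (Op Add (Reg 3) (Op Add (Op Mul (Const 5) (Reg 4)) (Const 4))) (Reg 5),
         Cond (Op Less (Reg 5) (Reg 6)) (Assign 0 (Reg 6)) (Assign 0 (Reg 5))])"

section \<open>Maxima over index ranges and the table of left-half maxima\<close>

definition range_max :: "(nat \<Rightarrow> int) \<Rightarrow> nat \<Rightarrow> nat \<Rightarrow> int" where
  "range_max d l r = Max (d ` {l..<r})"

lemma range_max_split:
  assumes "l < m" "m < r"
  shows "range_max d l r = max (range_max d l m) (range_max d m r)"
proof -
  have "{l..<r} = {l..<m} \<union> {m..<r}" using assms by auto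
  then show ?thesis
    using assms by (simp add: range_max_def image_Un Max_Un)
qed

lemma le_range_max_iff: "l < r \<Longrightarrow> x \<le> range_max d l r \<longleftrightarrow> (\<exists>i\<in>{l..<r}. x \<le> d i)"
  unfolding range_max_def by (subst Max_ge_iff) auto

lemma range_max_in: "l < r \<Longrightarrow> \<exists>i\<in>{l..<r}. range_max d l r = d i"
proof -
  assume "l < r"
  then have "range_max d l r \<in> d ` {l..<r}" unfolding range_max_def by (intro Max_in) auto
  then show ?thesis by (rule imageE) blast
qed

text \<open>The recursion uses the midpoints of the later batch recursion, so that every batch split
  finds the maximum of its left half in its own fifth word.\<close>

function max_table :: "mem \<Rightarrow> int \<Rightarrow> (nat \<Rightarrow> int) \<Rightarrow> nat \<Rightarrow> nat \<Rightarrow> bool" where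
  "max_table M f d l r \<longleftrightarrow> (if r < l + 2 then True else
     M (f + 5 * int ((l + r) div 2) + 4) = range_max d l ((l + r) div 2) \<and>
     max_table M f d l ((l + r) div 2) \<and> max_table M f d ((l + r) div 2) r)"
  by pat_completeness auto
termination by (relation "measure (\<lambda>(M, f, d, l, r). r - l)") auto

declare max_table.simps [simp del]

text \<open>All splits of a range lie strictly between its ends. Storing the value of a split at
  \<open>m\<close> therefore disturbs neither of the tables that meet at \<open>m\<close>.\<close>

lemma max_table_cong:
  "max_table M f d l r \<Longrightarrow> (\<And>a. f + 5 * (int l + 1) \<le> a \<Longrightarrow> a < f + 5 * int r \<Longrightarrow> M' a = M a) \<Longrightarrow>
    max_table M' f d l r"
proof (induction M f d l r rule: max_table.induct)
  case (1 M f d l r)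
  show ?case
  proof (cases "r < l + 2")
    case True
    then show ?thesis by (subst max_table.simps) simp
  next
    case False
    define m where "m = (l + r) div 2"
    have m: "l < m" "m < r" using False unfolding m_def by auto
    have "M (f + 5 * int m + 4) = range_max d l m" "max_table M f d l m" "max_table M f d m r"
      using "1.prems"(1) False unfolding m_def by (subst (asm) max_table.simps, simp)+
    moreover have "M' (f + 5 * int m + 4) = M (f + 5 * int m + 4)"
      using m by (intro "1.prems"(2)) auto
    moreover have "max_table M' f d l m"
      using 1(1)[folded m_def] False calculation(2) m by (intro 1(1)[folded m_def] "1.prems"(2)) auto
    moreover have "max_table M' f d m r"
      using False calculation(3) m by (intro 1(2)[folded m_def] "1.prems"(2)) auto
    ultimately show ?thesis by (subst max_table.simps) (simp add: m_def)
  qed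
qed

locale scan =
  fixes W :: int and \<Pi> :: program and M :: mem and f b :: int and n :: nat and dp :: "nat \<Rightarrow> int"
  assumes progs: "3 < length \<Pi>" "\<Pi> ! 3 = scan_proc"
    and M_le: "\<And>a. 0 \<le> a \<Longrightarrow> a < f \<Longrightarrow> \<bar>M a\<bar> \<le> W"
    and b: "0 \<le> b" "b + 3 * int n \<le> f"
    and W: "f + 5 * int n + 5 \<le> W"
    and dp: "\<And>i. i < n \<Longrightarrow> M (b + 3 * int i + 2) = dp i"
begin

lemma dp_le: "i < n \<Longrightarrow> \<bar>dp i\<bar> \<le> W"
  unfolding dp[symmetric] using b by (intro M_le) auto

lemma range_max_dp_le: "l < r \<Longrightarrow> r \<le> n \<Longrightarrow> \<bar>range_max dp l r\<bar> \<le> W"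
  using range_max_in[of l r dp] dp_le by fastforce

text \<open>A range of \<open>r - l\<close> entries causes \<open>2 * (r - l) - 1\<close> calls; the
  missing unit stands on the left, which avoids truncated subtraction.\<close>

definition scan_post where
  "scan_post l r j = (\<lambda>v M' w e R X. v = range_max dp l r \<and> max_table M' f dp l r \<and>
     w + 60 \<le> 2 * (r - l) * 60 \<and> e \<le> (j + 1) * 60 \<and>
     R \<subseteq> {..<f} \<and> X \<subseteq> {f + 5 * (int l + 1)..<f + 5 * int r})"

lemma scan_post_join:
  assumes m: "l < m" "m < r" "m = (l + r) div 2"
    and 1: "scan_post l m j v1 M1 w1 e1 R1 X1" and 2: "scan_post m r j v2 M2 w2 e2 R2 X2"
    and M': "\<And>a. a \<notin> X2 \<Longrightarrow> M' a = M1 a" "\<And>a. a \<notin> X1 \<Longrightarrow> M' a = M2 a"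
    and w: "w \<le> w1 + w2 + 60" "e \<le> max e1 e2 + 60" and v: "v = max v1 v2"
  shows "scan_post l r (Suc j) v (M'(f + (5 * int m + 4) := v1)) w e (R1 \<union> R2) (insert (f + (5 * int m + 4)) (X1 \<union> X2))"
proof -
  have X: "X1 \<subseteq> {f + 5 * (int l + 1)..<f + 5 * int m}" "X2 \<subseteq> {f + 5 * (int m + 1)..<f + 5 * int r}"
    using 1 2 unfolding scan_post_def by auto
  have t: "max_table M1 f dp l m" "max_table M2 f dp m r" using 1 2 unfolding scan_post_def by auto
  have "max_table (M'(f + (5 * int m + 4) := v1)) f dp l m"
  proof (rule max_table_cong[OF t(1)])
    fix a assume a: "f + 5 * (int l + 1) \<le> a" "a < f + 5 * int m"
    then have "a \<notin> X2" using X(2) by fastforce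
    then show "(M'(f + (5 * int m + 4) := v1)) a = M1 a" using a M'(1) by simp
  qed
  moreover have "max_table (M'(f + (5 * int m + 4) := v1)) f dp m r"
  proof (rule max_table_cong[OF t(2)])
    fix a assume a: "f + 5 * (int m + 1) \<le> a" "a < f + 5 * int r"
    then have "a \<notin> X1" using X(1) by fastforce
    then show "(M'(f + (5 * int m + 4) := v1)) a = M2 a" using a M'(2) by simp
  qed
  ultimately have "max_table (M'(f + (5 * int m + 4) := v1)) f dp l r"
    using 1 m(3) by (subst max_table.simps) (auto simp: scan_post_def add.assoc)
  moreover have "w + 60 \<le> 2 * (r - l) * 60"
    using w(1) 1 2 m(1,2) unfolding scan_post_def by auto
  moreover have "insert (f + (5 * int m + 4)) (X1 \<union> X2) \<subseteq> {f + 5 * (int l + 1)..<f + 5 * int r}"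
    using X m(1,2) by auto
  ultimately show ?thesis
    using 1 2 w(2) v range_max_split[OF m(1,2), of dp] unfolding scan_post_def by auto
qed

lemma wp_proc_scan_leaf:
  assumes "r = l + 1" "r \<le> n"
  shows "wp_proc W \<Pi> 3 [int l, int r, b, f] M (scan_post l r j)"
proof -
  have fits: "\<bar>int l\<bar> \<le> W" "\<bar>int r\<bar> \<le> W" "int l \<le> W" "1 \<le> W" "3 \<le> W" "\<bar>b\<bar> \<le> W" "\<bar>3 * int l\<bar> \<le> W"
    "3 * int l \<le> W" "\<bar>b + 3 * int l\<bar> \<le> W" "\<bar>b + 3 * int l + 2\<bar> \<le> W" "b + 3 * int l + 2 < f"
    "1 + int l \<le> W" "int l + 1 \<le> W"
    using assms b W by auto
  show ?thesis
    using progs fits assms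
    by (simp add: wp_proc_def scan_proc_def scan_post_def range_max_def dp max_table.simps)
qed

lemma wp_proc_scan:
  "l < r \<Longrightarrow> r \<le> n \<Longrightarrow> r - l \<le> 2 ^ j \<Longrightarrow>
    wp_proc W \<Pi> 3 [int l, int r, b, f] M (scan_post l r j)"
proof (induction j arbitrary: l r)
  case 0
  then show ?case by (intro wp_proc_scan_leaf) auto
next
  case (Suc j)
  show ?case
  proof (cases "r = l + 1")
    case True
    then show ?thesis using wp_proc_scan_leaf Suc.prems by blast
  next
    case False
    then have lr: "l + 2 \<le> r" using Suc.prems(1) by simp
    define m where "m = (l + r) div 2"
    have m: "l < m" "m < r" "(int l + int r) div 2 = int m"
      using lr unfolding m_def by (auto simp: zdiv_int)
    have IH1: "wp_proc W \<Pi> 3 [int l, int m, b, f] M (scan_post l m j)"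
      by (rule Suc.IH) (use m lr Suc.prems in \<open>auto simp: m_def\<close>)
    have IH2: "wp_proc W \<Pi> 3 [int m, int r, b, f] M (scan_post m r j)"
      by (rule Suc.IH) (use m lr Suc.prems in \<open>auto simp: m_def\<close>)
    have fits: "int l \<le> W" "int r \<le> W" "int l + int r \<le> W" "int m \<le> W" "5 * int m \<le> W" "5 * int m + 4 \<le> W"
      "\<bar>f + (5 * int m + 4)\<bar> \<le> W" "\<bar>b\<bar> \<le> W" "\<bar>f\<bar> \<le> W" "5 \<le> W" "\<bar>int r - int l\<bar> \<le> W"
      using m Suc.prems b W by auto
    have vs: "\<bar>range_max dp l m\<bar> \<le> W" "\<bar>range_max dp m r\<bar> \<le> W"
      using m Suc.prems by (auto intro: range_max_dp_le)
    have race: "X1 \<inter> (R2 \<union> X2) = {} \<and> X2 \<inter> (R1 \<union> X1) = {}"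
      if "scan_post l m j r1 M1 w1 e1 R1 X1" "scan_post m r j r2 M2 w2 e2 R2 X2"
      for r1 r2 M1 M2 w1 w2 e1 e2 R1 R2 X1 X2
      using that unfolding scan_post_def by fastforce
    show ?thesis
      using progs lr fits
      apply (simp add: wp_proc_def[of _ _ _ "[int l, int r, b, f]"] scan_proc_def m(3))
      apply (rule wp_Fork[OF _ _ IH1 _ IH2])
         apply (simp_all add: args_cost_def)
       apply (erule (1) race)
      subgoal premises prems for v1 M1 w1 d1 R1 X1 v2 M2 w2 d2 R2 X2 M'
      proof -
        have "\<bar>v1\<bar> \<le> W" "\<bar>v2\<bar> \<le> W" using prems(10,11) vs by (auto simp: scan_post_def)
        note J = scan_post_join[OF m(1,2) m_def prems(10-13)]
        show ?thesis
        proof (cases "v1 < v2")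
          case True
          then show ?thesis
            using \<open>\<bar>v1\<bar> \<le> W\<close> \<open>\<bar>v2\<bar> \<le> W\<close> by simp (rule J, simp_all)
        next
          case False
          then show ?thesis
            using \<open>\<bar>v1\<bar> \<le> W\<close> \<open>\<bar>v2\<bar> \<le> W\<close> by simp (rule J, simp_all)
        qed
      qed
      done
  qed
qed

end

section \<open>Covered keys of the whole batch\<close>

definition max_code :: "nat \<Rightarrow> nat \<Rightarrow> com" where
  "max_code a b = Cond (Op Less (Reg a) (Reg b)) (Assign a (Reg b)) Skip"

lemma wp_max_code:
  assumes "0 \<le> W" "1 \<le> W" "\<bar>s a\<bar> \<le> W" "\<bar>s b\<bar> \<le> W"
    and "\<And>w. w \<le> 6 \<Longrightarrow> Q (s(a := max (s a) (s b))) M w w {} {}"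
  shows "wp W \<Pi> (max_code a b) s M Q"
  using assms by (cases "s a < s b") (auto simp: max_code_def max_def)

text \<open>The offset 4 leads to the key of the next batch point. The last point has no right
  neighbour, and the maximum in the root of the tree closes its interval, so the program need not be
  told \<open>U\<close>.\<close>

definition batch_leaf :: com where
  "batch_leaf = seqs [
     Load 8 (Op Add (Reg 5) (Op Add (Op Mul (Const 3) (Reg 0)) (Const 1))),
     Load 9 (Op Add (Reg 5) (Op Add (Op Mul (Const 3) (Reg 0)) (Const 2))),
     max_code 2 9,
     Cond (Op Less (Op Add (Reg 0) (Const 1)) (Reg 6))
       (Load 10 (Op Add (Reg 5) (Op Add (Op Mul (Const 3) (Reg 0)) (Const 4))))
       (Load 10 (Op Add (Reg 3) (Const 2))),
     Call 0 2 [Reg 8, Reg 10, Reg 2, Reg 3, Reg 4, Op Add (Reg 7) (Op Mul (Const 5) (Reg 6)), Reg 7]]"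

definition batch_node :: com where
  "batch_node = seqs [
     Assign 8 (Op Quot (Op Add (Reg 0) (Reg 1)) (Const 2)),
     Load 9 (Op Add (Reg 7) (Op Add (Op Mul (Const 5) (Reg 8)) (Const 4))),
     max_code 9 2,
     Fork 10 4 [Reg 0, Reg 8, Reg 2, Reg 3, Reg 4, Reg 5, Reg 6, Reg 7]
          11 4 [Reg 8, Reg 1, Reg 9, Reg 3, Reg 4, Reg 5, Reg 6, Reg 7],
     Assign 0 (Op Add (Reg 7) (Op Mul (Const 5) (Reg 8))),
     join_code 0 (Const (-1))]"

definition batch_proc :: com where
  "batch_proc = Cond (Op Less (Op Sub (Reg 1) (Reg 0)) (Const 2)) batch_leaf batch_node"

text \<open>Batch slots fill the \<open>5 * n\<close> words from \<open>f\<close> on, whence the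
  base \<open>f + 5 * int n\<close> of the key slots. A split index is never 0, so slot 0 is free to
  hold the empty tree at \<open>f\<close>.\<close>

locale batch = mono_keys W \<Pi> M f v t "f + 5 * int n" k J U S + scan W \<Pi> M f b n dp
  for W \<Pi> M f v t b k J U S n dp +
  fixes ys :: "nat \<Rightarrow> nat"
  assumes progs4: "4 < length \<Pi>" "\<Pi> ! 4 = batch_proc"
    and ys: "\<And>i. i < n \<Longrightarrow> M (b + 3 * int i + 1) = int (ys i)" "\<And>i. i < n \<Longrightarrow> ys i < U"
      "\<And>i i'. i \<le> i' \<Longrightarrow> i' < n \<Longrightarrow> ys i \<le> ys i'"
    and maxima: "max_table M f dp 0 n"
begin

text \<open>For the last interval, \<open>U - 1\<close> only bounds the address range; the program
  stops at the largest stored key, which selects the same keys.\<close>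

definition E :: "nat \<Rightarrow> int" where "E r = (if r < n then int (ys r) else int U - 1)"

text \<open>\<open>d\<close> summarizes the batch points before \<open>l\<close>: their keys are at
  most \<open>ys l\<close>, so among the keys considered here only the scores matter.\<close>

definition covered :: "nat \<Rightarrow> nat \<Rightarrow> int \<Rightarrow> nat set" where
  "covered l r d = {s \<in> S. ys l < s \<and> int s \<le> E r \<and>
     (score s \<le> d \<or> (\<exists>i. l \<le> i \<and> i < r \<and> ys i < s \<and> score s \<le> dp i))}"

definition batch_region :: "nat \<Rightarrow> nat \<Rightarrow> int set" where
  "batch_region l r = {f + 5 * (int l + 1)..<f + 5 * int r} \<union> key_region (int (ys l)) (E r)"

text \<open>There are \<open>r - l - 1\<close> split nodes besides the key nodes, hence the strict
  bound on \<open>N\<close>. Each batch point is charged three units: the surplus failing call of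
  its interval, its own leaf, and a split. The \<open>Q\<close> on the left is the unit left over
  for the split above.\<close>

definition batch_post where
  "batch_post l r d j = (\<lambda>p M' w e R X. \<exists>xs N h.
     tree M' f ({f} \<union> batch_region l r) p xs N h \<and> N < length xs + (r - l) \<and> h \<le> j + k \<and>
     sorted_wrt (<) xs \<and> set xs = covered l r d \<and>
     w + Q \<le> (2 * length xs + 3 * (r - l)) * Q \<and> e \<le> (j + k + 2) * Q \<and>
     R \<subseteq> {..f} \<union> batch_region l r \<and> X \<subseteq> batch_region l r)"

lemma batch_post_mono:
  assumes "batch_post l r d j p M' w e R X" "w' \<le> w" "e' \<le> e" "R' \<subseteq> R"
  shows "batch_post l r d j p M' w' e' R' X"
  using assms(1) add_le_mono1[OF assms(2), of Q] assms(3,4) unfolding batch_post_def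
  by (meson order_trans)

text \<open>A key up to \<open>ys m\<close> is out of reach of all points from \<open>m\<close> on,
  by strictness. A key beyond \<open>ys m\<close> lies above all points before \<open>m\<close>, so
  these act through their maximal score alone.\<close>

lemma covered_split:
  assumes "l < m" "m < r" "r \<le> n"
  shows "covered l r d = covered l m d \<union> covered m r (max (range_max dp l m) d)"
proof (intro set_eqI iffI)
  fix s assume s: "s \<in> covered l r d"
  show "s \<in> covered l m d \<union> covered m r (max (range_max dp l m) d)"
  proof (cases "s \<le> ys m")
    case True
    then have "i < m" if "ys i < s" "i < r" for i
      using ys(3)[of m i] that assms by fastforce
    then show ?thesis using s True assms unfolding covered_def E_def by auto
  next
    case False
    have "range_max dp l m \<ge> score s \<or> m \<le> i" if "l \<le> i" "score s \<le> dp i" for i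
      using that assms(1) by (auto simp: le_range_max_iff)
    then show ?thesis using s False assms unfolding covered_def by (auto simp: le_max_iff_disj)
  qed
next
  fix s assume s: "s \<in> covered l m d \<union> covered m r (max (range_max dp l m) d)"
  have lm: "ys l \<le> ys m" using ys(3)[of l m] assms by simp
  then show "s \<in> covered l r d"
  proof (cases "s \<in> covered l m d")
    case True
    have "int s \<le> E r"
      using True assms ys(3)[of m r] S by (auto simp: covered_def E_def)
    then show ?thesis using True assms unfolding covered_def by auto
  next
    case False
    then have s': "s \<in> S" "ys m < s" "int s \<le> E r"
      "score s \<le> range_max dp l m \<or> score s \<le> d \<or> (\<exists>i. m \<le> i \<and> i < r \<and> ys i < s \<and> score s \<le> dp i)"
      using s unfolding covered_def by (auto simp: le_max_iff_disj)
    have "\<exists>i. l \<le> i \<and> i < r \<and> ys i < s \<and> score s \<le> dp i" if le: "score s \<le> range_max dp l m"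
    proof -
      obtain i where "i \<in> {l..<m}" "score s \<le> dp i" using le assms(1) by (auto simp: le_range_max_iff)
      moreover have "ys i \<le> ys m" using ys(3)[of i m] calculation(1) assms by simp
      ultimately show ?thesis using s'(2) assms by (intro exI[of _ i]) auto
    qed
    then show ?thesis using s' lm assms unfolding covered_def by (auto intro: order_trans less_imp_le)
  qed
qed

lemma max_key:
  "-1 \<le> M (v + 2)" "M (v + 2) < int U" "\<And>s. s \<in> S \<Longrightarrow> int s \<le> M (v + 2)" "0 \<le> v" "v + 5 \<le> f"
proof -
  have *: "M (v + 2) = (if S = {} then -1 else int (Max S))" "0 \<le> v" "v + 5 \<le> f"
    using veb by (subst (asm) veb_at.simps, simp)+
  have fin: "finite S" using S finite_subset by blast
  then have "S \<noteq> {} \<Longrightarrow> Max S \<in> S" by simp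
  then show "-1 \<le> M (v + 2)" "M (v + 2) < int U" "\<And>s. s \<in> S \<Longrightarrow> int s \<le> M (v + 2)" "0 \<le> v" "v + 5 \<le> f"
    using * S Max_ge[OF fin] by auto
qed

lemma Uk: "int U \<le> 2 ^ k"
  using of_nat_mono[OF k(2), where 'a = int] by (simp only: of_nat_power of_nat_numeral)

lemma wp_batch_leaf:
  assumes lr: "r = l + 1" "r \<le> n" and d: "\<bar>d\<bar> \<le> W"
    and regs: "\<sigma> 0 = int l" "\<sigma> 2 = d" "\<sigma> 3 = v" "\<sigma> 4 = t" "\<sigma> 5 = b" "\<sigma> 6 = int n" "\<sigma> 7 = f"
    and c: "c \<le> 30"
  shows "wp W \<Pi> batch_leaf \<sigma> M (\<lambda>\<sigma>' M' w e. batch_post l r d j (\<sigma>' 0) M' (w + c) (e + c))"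
proof -
  define H where "H = (if r < n then int (ys r) else M (v + 2))"
  have H: "-1 \<le> H" "H < int U" "H \<le> E r"
    using max_key(1,2) ys(2) unfolding H_def E_def by auto
  \<comment> \<open>No stored key exceeds the stored maximum, so ending at \<open>H\<close> instead
    of \<open>E r\<close> loses nothing; the only point of the range enters through its
    score.\<close>
  have sets: "{s \<in> S. int (ys l) < int s \<and> int s \<le> H \<and> score s \<le> max d (dp l)} = covered l r d"
    using lr max_key(3) S unfolding covered_def H_def E_def
    by (auto simp: le_max_iff_disj less_Suc_eq_le dest: le_antisym)
  have key: "wp_proc W \<Pi> 2 [int (ys l), H, max d (dp l), v, t, f + 5 * int n, f] M
      (key_post 0 (int (ys l)) H (max d (dp l)) k)"
  proof (rule wp_proc_key)
    have "H - int (ys l) < 2 ^ k" using H(2) Uk by linarith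
    then show "H - int (ys l) < 2 ^ k" .
  qed (use H lr ys(2) d dp_le[of l] in auto)
  have post: "batch_post l r d j p M' w' e' R' X"
    if p: "key_post 0 (int (ys l)) H (max d (dp l)) k p M' w e R X"
      and c: "w' \<le> w + 150" "e' \<le> e + 150" "R' \<subseteq> {..f} \<union> R" for p M' w e w' e' R R' X
  proof -
    from p obtain xs h where p: "tree M' f ({f} \<union> key_region (int (ys l)) H) p xs (length xs) h"
      "h \<le> k" "sorted_wrt (<) xs" "set xs = covered l r d"
      "w \<le> (2 * length xs + 1) * Q" "e \<le> (k + 1) * Q"
      "R \<subseteq> {..f} \<union> key_region (int (ys l)) H" "X \<subseteq> key_region (int (ys l)) H"
      unfolding key_post_def sets by auto
    have sub: "key_region (int (ys l)) H \<subseteq> batch_region l r"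
      using H(3) unfolding key_region_def batch_region_def by auto
    have "w' + Q \<le> a + Q + Q" "e' \<le> a' + Q" if "w \<le> a" "e \<le> a'" for a a'
      using c that by simp_all
    from this[OF p(5,6)] have "w' + Q \<le> (2 * length xs + 3 * (r - l)) * Q" "e' \<le> (k + 2) * Q"
      using lr(1) by (simp_all add: algebra_simps)
    moreover from this(2) have "e' \<le> (j + k + 2) * Q"
      by (rule order_trans) (intro mult_le_mono1, simp)
    moreover have "tree M' f ({f} \<union> batch_region l r) p xs (length xs) h"
      by (rule tree_mono[OF p(1)]) (use sub in auto)
    moreover have "R' \<subseteq> {..f} \<union> batch_region l r" "X \<subseteq> batch_region l r"
      using p(7,8) c(3) sub by blast+
    ultimately show ?thesis
      unfolding batch_post_def using p(2-4)
      by - (rule exI[of _ xs], rule exI[of _ "length xs"], rule exI[of _ h], use lr(1) in auto)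
  qed
  have l: "l < n" using lr by simp
  have n: "0 \<le> f" "0 \<le> t" "t \<le> f" "0 \<le> b" "b + 3 * int n \<le> f" "f + 5 * int n + 5 \<le> W" "0 \<le> v" "v + 5 \<le> f"
    using table b W max_key(4,5) by linarith+
  have fits: "0 \<le> W" "1 \<le> W" "2 \<le> W" "3 \<le> W" "4 \<le> W" "5 \<le> W" "\<bar>b\<bar> \<le> W" "\<bar>f\<bar> \<le> W" "\<bar>v\<bar> \<le> W" "\<bar>v + 2\<bar> \<le> W" "\<bar>t\<bar> \<le> W"
    "int l \<le> W" "3 * int l \<le> W" "3 * int l + 1 \<le> W" "3 * int l + 2 \<le> W" "3 * int l + 4 \<le> W"
    "\<bar>b + (3 * int l + 1)\<bar> \<le> W" "\<bar>b + (3 * int l + 2)\<bar> \<le> W" "\<bar>b + (3 * int l + 4)\<bar> \<le> W"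
    "1 + int l \<le> W" "int l + 1 \<le> W" "int n \<le> W" "5 * int n \<le> W" "\<bar>f + 5 * int n\<bar> \<le> W"
    using n l by (simp_all add: abs_le_iff)
  have rd: "M (b + (3 * int l + 1)) = int (ys l)" "M (b + (3 * int l + 2)) = dp l"
    using ys(1)[OF l] dp[OF l] by (simp_all add: add.assoc)
  have "\<bar>dp l\<bar> \<le> W" using dp_le[OF l] .
  have md: "\<bar>max d (dp l)\<bar> \<le> W" using d dp_le[OF l] by (simp add: max_def)
  have big: "int U \<le> W" using g(2) n(1) by linarith
  have ysW: "int (ys l) \<le> W" "\<bar>H\<bar> \<le> W" using ys(2)[OF l] H big by auto
  have hi: "int l + 1 < int n \<Longrightarrow> M (b + (3 * int l + 4)) = H"
    "\<not> int l + 1 < int n \<Longrightarrow> M (v + 2) = H"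
    using ys(1)[of "l + 1"] lr unfolding H_def by (auto simp: algebra_simps)
  show ?thesis
    apply (simp add: batch_leaf_def regs rd)
    apply (intro conjI fits)
    apply (rule wp_max_code)
        apply (simp_all add: fits regs d dp_le[OF l])
    apply (intro conjI impI ysW md)
    subgoal using hi ysW by simp
    subgoal
      apply (subst hi(1), assumption)
      apply (rule wp_proc_mono[OF key])
      apply (erule post)
        apply (simp_all (no_asm_simp) add: args_cost_def)
      subgoal using c by simp
      subgoal using c by simp
      using n l by auto
    subgoal using hi ysW by simp
    subgoal
      apply (subst hi(2), assumption)
      apply (rule wp_proc_mono[OF key])
      apply (erule post)
        apply (simp_all (no_asm_simp) add: args_cost_def)
      subgoal using c by simp
      subgoal using c by simp
      using n l by auto
    done
qed

lemma length_le_W: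
  assumes "set xs \<subseteq> S" "sorted_wrt (<) xs"
  shows "int (length xs) \<le> W"
proof -
  have "length xs = card (set xs)" using assms(2) by (simp add: strict_sorted_iff distinct_card)
  also have "\<dots> \<le> card {..<U}" using assms(1) S by (intro card_mono) auto
  finally show ?thesis using g table by simp
qed

lemma wp_batch_node:
  assumes IH: "\<And>l r d. l < r \<Longrightarrow> r \<le> n \<Longrightarrow> r - l \<le> 2 ^ j \<Longrightarrow> \<bar>d\<bar> \<le> W \<Longrightarrow> max_table M f dp l r \<Longrightarrow>
      wp_proc W \<Pi> 4 [int l, int r, d, v, t, b, int n, f] M (batch_post l r d j)"
    and lr: "l + 2 \<le> r" "r \<le> n" "r - l \<le> 2 ^ Suc j" and d: "\<bar>d\<bar> \<le> W"
    and tab: "max_table M f dp l r"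
    and regs: "\<sigma> 0 = int l" "\<sigma> 1 = int r" "\<sigma> 2 = d" "\<sigma> 3 = v" "\<sigma> 4 = t" "\<sigma> 5 = b" "\<sigma> 6 = int n" "\<sigma> 7 = f"
    and c: "c \<le> 30"
  shows "wp W \<Pi> batch_node \<sigma> M (\<lambda>\<sigma>' M' w e. batch_post l r d (Suc j) (\<sigma>' 0) M' (w + c) (e + c))"
proof -
  define m where "m = (l + r) div 2"
  have m: "l < m" "m < r" "(int l + int r) div 2 = int m"
    using lr unfolding m_def by (auto simp: zdiv_int)
  define d' where "d' = max (range_max dp l m) d"
  have tabs: "M (f + (5 * int m + 4)) = range_max dp l m" "max_table M f dp l m" "max_table M f dp m r"
    using tab lr(1) unfolding m_def by (subst (asm) max_table.simps, simp add: add.assoc)+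
  have rm: "\<bar>range_max dp l m\<bar> \<le> W" using m lr by (intro range_max_dp_le) auto
  have d': "\<bar>d'\<bar> \<le> W" using rm d unfolding d'_def by (simp add: max_def)
  have "r - l \<le> 2 * 2 ^ j" using lr(3) by simp
  then have sz: "m - l \<le> 2 ^ j" "r - m \<le> 2 ^ j" unfolding m_def by linarith+
  have IH1: "wp_proc W \<Pi> 4 [int l, int m, d, v, t, b, int n, f] M (batch_post l m d j)"
    by (rule IH) (use m lr d tabs sz in auto)
  have IH2: "wp_proc W \<Pi> 4 [int m, int r, d', v, t, b, int n, f] M (batch_post m r d' j)"
    by (rule IH) (use m lr d' tabs sz in auto)
  have n: "0 \<le> f" "0 \<le> t" "t \<le> f" "0 \<le> b" "b + 3 * int n \<le> f" "f + 5 * int n + 5 \<le> W" "0 \<le> v" "v + 5 \<le> f"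
    "l < n" "m < n" "r \<le> n"
    using table b W max_key(4,5) m lr by linarith+
  have fits: "0 \<le> W" "1 \<le> W" "2 \<le> W" "3 \<le> W" "4 \<le> W" "5 \<le> W" "\<bar>b\<bar> \<le> W" "\<bar>f\<bar> \<le> W" "\<bar>v\<bar> \<le> W" "\<bar>t\<bar> \<le> W"
    "int l \<le> W" "int r \<le> W" "int l + int r \<le> W" "int m \<le> W" "5 * int m \<le> W" "5 * int m + 4 \<le> W"
    "\<bar>f + (5 * int m + 4)\<bar> \<le> W" "\<bar>f + 5 * int m\<bar> \<le> W" "int n \<le> W"
    using n by (simp_all add: abs_le_iff)
  define p where "p = f + 5 * int m"
  have E: "E m = int (ys m)" "int (ys l) \<le> E m" "E m \<le> E r" "E r < int U"
    using ys(3)[of l m] ys(3)[of m r] ys(2)[of m] ys(2)[of r] n m unfolding E_def by auto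
  \<comment> \<open>The word \<open>p + 4\<close> with the scan result lies in the region of the
    whole range but in neither half: it may be read here, and no descendant writes it.\<close>
  have regions: "batch_region l m \<inter> batch_region m r = {}"
    "batch_region l m \<inter> {..f} = {}" "batch_region m r \<inter> {..f} = {}"
    "{p..<p + 4} \<inter> (({f} \<union> batch_region l m) \<union> ({f} \<union> batch_region m r)) = {}"
    "({f} \<union> batch_region l m) \<union> ({f} \<union> batch_region m r) \<subseteq> {0..W}"
    "{p..<p + 4} \<subseteq> batch_region l r" "p + 4 \<in> batch_region l r"
    "batch_region l m \<subseteq> batch_region l r" "batch_region m r \<subseteq> batch_region l r"
    using n m E g unfolding batch_region_def key_region_def p_def by auto
  have split: "covered l r d = covered l m d \<union> covered m r d'"
    unfolding d'_def by (rule covered_split[OF m(1,2) lr(2)])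
  have race: "X1 \<inter> (R2 \<union> X2) = {} \<and> X2 \<inter> (R1 \<union> X1) = {}"
    if "batch_post l m d j r1 M1 w1 e1 R1 X1" "batch_post m r d' j r2 M2 w2 e2 R2 X2"
    for r1 r2 M1 M2 w1 w2 e1 e2 R1 R2 X1 X2
    using that regions(1-3) unfolding batch_post_def by blast
  have join: "wp W \<Pi> (join_code 0 (Const (-1))) \<rho> M'
        (\<lambda>\<sigma>' M2' w e R X. batch_post l r d (Suc j) (\<sigma>' 0) M2'
          (c' + w1 + w2 + w) (c' + max e1 e2 + e) (insert (p + 4) (R1 \<union> R2 \<union> R)) (X1 \<union> X2 \<union> X))"
    if c': "c' \<le> 150" and \<rho>: "\<rho> 0 = p" "\<rho> 10 = r1" "\<rho> 11 = r2"
      and r1: "batch_post l m d j r1 M1 w1 e1 R1 X1"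
      and r2: "batch_post m r d' j r2 M2 w2 e2 R2 X2"
      and M1: "\<And>a. a \<notin> X2 \<Longrightarrow> M' a = M1 a" and M2: "\<And>a. a \<notin> X1 \<Longrightarrow> M' a = M2 a"
    for \<rho> r1 r2 M1 M2 M' w1 w2 e1 e2 R1 R2 X1 X2 c'
  proof -
    from r1 obtain xs1 N1 h1 where 1: "tree M1 f ({f} \<union> batch_region l m) r1 xs1 N1 h1"
      "N1 < length xs1 + (m - l)" "h1 \<le> j + k" "sorted_wrt (<) xs1" "set xs1 = covered l m d"
      "w1 + Q \<le> (2 * length xs1 + 3 * (m - l)) * Q" "e1 \<le> (j + k + 2) * Q"
      "R1 \<subseteq> {..f} \<union> batch_region l m" "X1 \<subseteq> batch_region l m"
      unfolding batch_post_def by auto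
    from r2 obtain xs2 N2 h2 where 2: "tree M2 f ({f} \<union> batch_region m r) r2 xs2 N2 h2"
      "N2 < length xs2 + (r - m)" "h2 \<le> j + k" "sorted_wrt (<) xs2" "set xs2 = covered m r d'"
      "w2 + Q \<le> (2 * length xs2 + 3 * (r - m)) * Q" "e2 \<le> (j + k + 2) * Q"
      "R2 \<subseteq> {..f} \<union> batch_region m r" "X2 \<subseteq> batch_region m r"
      unfolding batch_post_def by auto
    have t1: "tree M' f ({f} \<union> batch_region l m) r1 xs1 N1 h1"
      by (rule tree_mono[OF 1(1) M1]) (use regions 2(9) in auto)
    have t2: "tree M' f ({f} \<union> batch_region m r) r2 xs2 N2 h2"
      by (rule tree_mono[OF 2(1) M2]) (use regions 1(9) in auto)
    let ?xs = "[] @ xs1 @ xs2"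
    have "x < y" if "x \<in> set xs1" "y \<in> set xs2" for x y
      using that E(1) unfolding 1(5) 2(5) covered_def by auto
    then have sorted: "sorted_wrt (<) ?xs"
      using 1(4) 2(4) by (simp add: sorted_wrt_append)
    have set: "set ?xs = covered l r d" using split 1(5) 2(5) by simp
    then have len: "int (length ?xs) \<le> W" using length_le_W[OF _ sorted] unfolding covered_def by auto
    show ?thesis
    proof (rule wp_mono[OF wp_join[where y = "-1" and own = "[]", OF t1 t2 \<rho> regions(5,4)]],
        goal_cases)
      case (9 s' M2' w e R X)
      then have *: "s' 0 = p"
        "tree M2' f ({p..<p + 4} \<union> ({f} \<union> batch_region l m) \<union> ({f} \<union> batch_region m r)) p ?xs
           (N1 + N2 + 1) (max h1 h2 + 1)"
        "w \<le> 60" "e \<le> 60" "R \<subseteq> insert f (batch_region l m \<union> batch_region m r)"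
        "X \<subseteq> {p..<p + 4}" by auto
      have "tree M2' f ({f} \<union> batch_region l r) p ?xs (N1 + N2 + 1) (max h1 h2 + 1)"
        by (rule tree_mono[OF *(2)]) (use regions(6,8,9) in auto)
      moreover have "c' + w1 + w2 + w + Q \<le> (2 * length ?xs + 3 * (r - l)) * Q"
      proof -
        have "c' + w1 + w2 + w + Q \<le> A + B" if "w1 + Q \<le> A" "w2 + Q \<le> B" for A B
          using that c' *(3) by simp
        from this[OF 1(6) 2(6)]
        have "c' + w1 + w2 + w + Q \<le> (2 * length xs1 + 3 * (m - l)) * Q + (2 * length xs2 + 3 * (r - m)) * Q" .
        also have "\<dots> = (2 * length xs1 + 3 * (m - l) + (2 * length xs2 + 3 * (r - m))) * Q"
          by (rule add_mult_distrib[symmetric])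
        also have "2 * length xs1 + 3 * (m - l) + (2 * length xs2 + 3 * (r - m)) = 2 * length ?xs + 3 * (r - l)"
          using m by simp
        finally show ?thesis .
      qed
      moreover have "c' + max e1 e2 + e \<le> (Suc j + k + 2) * Q"
      proof -
        have "c' + max e1 e2 + e \<le> A + Q" if "e1 \<le> A" "e2 \<le> A" for A
          using that c' *(4) by simp
        from this[OF 1(7) 2(7)]
        have "c' + max e1 e2 + e \<le> (j + k + 2) * Q + Q" .
        then show ?thesis by simp
      qed
      moreover have "insert (p + 4) (R1 \<union> R2 \<union> R) \<subseteq> {..f} \<union> batch_region l r"
        "X1 \<union> X2 \<union> X \<subseteq> batch_region l r"
        using 1(8,9) 2(8,9) *(5,6) regions(6-9) by blast+
      moreover have "N1 + N2 + 1 < length ?xs + (r - l)" "max h1 h2 + 1 \<le> Suc j + k"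
        using 1(2,3) 2(2,3) m by auto
      ultimately show ?case
        unfolding batch_post_def *(1) using sorted set
        by - (rule exI[of _ ?xs], rule exI[of _ "N1 + N2 + 1"], rule exI[of _ "max h1 h2 + 1"], blast)
    qed (use len fits n in \<open>auto simp: p_def\<close>)
  qed
  show ?thesis
    apply (simp add: batch_node_def regs regs(2)[unfolded One_nat_def] m(3) tabs)
    apply (intro conjI fits)
    apply (rule wp_max_code)
        apply (simp_all add: fits regs d rm flip: d'_def)
    apply (rule wp_Fork[OF _ _ IH1 _ IH2])
        apply (simp (no_asm) add: regs regs(2)[unfolded One_nat_def])
        apply (intro conjI fits d d')
       apply (simp (no_asm) add: regs regs(2)[unfolded One_nat_def])
      apply (simp (no_asm) add: regs regs(2)[unfolded One_nat_def])
     apply (erule (1) race)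
    apply (simp (no_asm) add: regs args_cost_def)
    apply (intro conjI fits)
    subgoal premises prems for w v1 M1 w1 e1 R1 X1 v2 M2 w2 e2 R2 X2 M'
      \<comment> \<open>37 is the midpoint (6), the load of the recorded maximum (8), the fork with
        sixteen arguments (17) and the node address (6); \<open>w\<close> is the cost of taking the
        maximum.\<close>
      apply (rule wp_mono[OF join[of "37 + w + c", OF _ _ _ _ prems(2,3)]])
            apply (use prems(1) c in simp)
           apply (simp add: p_def)
          apply simp
         apply simp
        apply (erule prems(4))
       apply (erule prems(5))
      apply (erule batch_post_mono)
        apply (simp_all add: p_def add.assoc)
      done
    done
qed

lemma wp_proc_batch_leaf:
  assumes "r = l + 1" "r \<le> n" "\<bar>d\<bar> \<le> W"
  shows "wp_proc W \<Pi> 4 [int l, int r, d, v, t, b, int n, f] M (batch_post l r d j)"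
proof -
  have *: "int l \<le> W" "int r \<le> W" "1 + int l \<le> W" "2 \<le> W" "1 \<le> W"
    using assms W table by auto
  show ?thesis
    using assms progs4
    apply (simp add: wp_proc_def batch_proc_def)
    apply (intro conjI)
        apply (use * in \<open>simp; fail\<close>)+
    \<comment> \<open>6 is the cost of the size test that precedes the leaf code.\<close>
    apply (rule wp_mono[OF wp_batch_leaf[of r l d _ 6 j]])
               apply (simp_all add: add.commute)
    apply (erule batch_post_mono, simp_all)
    done
qed

lemma wp_proc_batch:
  "l < r \<Longrightarrow> r \<le> n \<Longrightarrow> r - l \<le> 2 ^ j \<Longrightarrow> \<bar>d\<bar> \<le> W \<Longrightarrow> max_table M f dp l r \<Longrightarrow>
    wp_proc W \<Pi> 4 [int l, int r, d, v, t, b, int n, f] M (batch_post l r d j)"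
proof (induction j arbitrary: l r d)
  case 0
  then have "r = l + 1" by simp
  then show ?case using wp_proc_batch_leaf 0 by blast
next
  case (Suc j)
  show ?case
  proof (cases "r = l + 1")
    case True
    then show ?thesis using wp_proc_batch_leaf Suc.prems by blast
  next
    case False
    have *: "int l \<le> W" "int r \<le> W" "int r - int l \<le> W" "2 \<le> W" "0 \<le> W" "l + 2 \<le> r"
      "2 \<le> int r - int l" "\<not> int r - int l < 2"
      using False Suc.prems(1,2) W table by auto
    show ?thesis
      using progs4 *(8)
      apply (simp add: wp_proc_def[of _ _ _ "[int l, int r, d, v, t, b, int n, f]"] batch_proc_def)
      apply (intro conjI *)
      apply (rule wp_mono[OF wp_batch_node[where l = l and r = r and d = d and c = 6 and j = j]])
                     apply (rule Suc.IH; assumption)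
                    apply (use *(6) Suc.prems in simp_all)
      apply (erule batch_post_mono, simp_all)
      done
  qed
qed

end

section \<open>Flattening a tree into an array\<close>

text \<open>The size of the left subtree fixes the offset of the right one, so both are laid out at
  once. Subtrees of size 0 are not entered, which also prunes batch splits without covered
  keys.\<close>

definition flatten_proc :: com where
  "flatten_proc = Seq (Load 3 (Reg 0)) (Cond (Reg 3) (seqs [
     Load 4 (Op Add (Reg 0) (Const 1)),
     Load 5 (Op Add (Reg 0) (Const 2)),
     Load 6 (Op Add (Reg 0) (Const 3)),
     Load 7 (Reg 4),
     Cond (Op Less (Reg 6) (Const 0))
       (Fork 10 5 [Reg 4, Reg 1, Reg 2] 11 5 [Reg 5, Op Add (Reg 1) (Op Mul (Const 3) (Reg 7)), Reg 2])
       (seqs [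
         Load 8 (Op Add (Reg 2) (Op Mul (Const 2) (Reg 6))),
         Load 9 (Op Add (Op Add (Reg 2) (Op Mul (Const 2) (Reg 6))) (Const 1)),
         Fork 10 5 [Reg 4, Op Add (Reg 1) (Const 3), Reg 2]
              11 5 [Reg 5, Op Add (Op Add (Reg 1) (Const 3)) (Op Mul (Const 3) (Reg 7)), Reg 2],
         Store (Reg 1) (Reg 8),
         Store (Op Add (Reg 1) (Const 1)) (Reg 6),
         Store (Op Add (Reg 1) (Const 2)) (Reg 9)])]) Skip)"

fun written :: "(nat \<Rightarrow> int) \<Rightarrow> (nat \<Rightarrow> int) \<Rightarrow> mem \<Rightarrow> int \<Rightarrow> nat list \<Rightarrow> bool" where
  "written X D M a [] \<longleftrightarrow> True"
| "written X D M a (y # ys) \<longleftrightarrow>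
     M a = X y \<and> M (a + 1) = int y \<and> M (a + 2) = D y \<and> written X D M (a + 3) ys"

lemma written_append:
  "written X D M a (ys @ zs) \<longleftrightarrow> written X D M a ys \<and> written X D M (a + 3 * int (length ys)) zs"
  by (induction ys arbitrary: a) (auto simp: algebra_simps)

lemma written_cong:
  "written X D M a ys \<Longrightarrow> (\<And>i. a \<le> i \<Longrightarrow> i < a + 3 * int (length ys) \<Longrightarrow> M' i = M i) \<Longrightarrow>
    written X D M' a ys"
  by (induction ys arbitrary: a) auto

lemma written_points_at:
  "written X D M a ys \<Longrightarrow> points_at M a (map (\<lambda>y. (X y, y, D y)) ys)"
proof (induction ys arbitrary: a)
  case (Cons y ys)
  then have "points_at M (a + 3) (map (\<lambda>y. (X y, y, D y)) ys)" by simp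
  with Cons.prems show ?case
    by (auto simp: points_at_def less_Suc_eq_0_disj algebra_simps)
qed (simp add: points_at_def)

text \<open>\<open>q\<close> separates the tree from the output: nodes lie in \<open>{f..<q}\<close>
  and points are written from \<open>q\<close> on, so nothing is overwritten that still has to be
  read.\<close>

locale flatten =
  fixes W :: int and \<Pi> :: program and M :: mem and f t q :: int and U :: nat and A :: "int set"
  assumes progs: "5 < length \<Pi>" "\<Pi> ! 5 = flatten_proc"
    and M_le: "\<And>a. 0 \<le> a \<Longrightarrow> a < f \<Longrightarrow> \<bar>M a\<bar> \<le> W"
    and table: "0 \<le> t" "t + 2 * int U \<le> f"
    and A: "A \<subseteq> {f..<q}" and q: "q + 3 \<le> W"
begin

definition X :: "nat \<Rightarrow> int" where "X y = M (t + 2 * int y)"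
definition D :: "nat \<Rightarrow> int" where "D y = M (t + 2 * int y + 1)"

definition flatten_post where
  "flatten_post off xs n h = (\<lambda>(v :: int) M' w e R Y. written X D M' off xs \<and>
     w \<le> (2 * n + 1) * 150 \<and> e \<le> (h + 1) * 150 \<and>
     R \<subseteq> {..<q} \<and> Y \<subseteq> {off..<off + 3 * int (length xs)})"

lemma wp_proc_flatten:
  "tree M f A p xs n h \<Longrightarrow> set xs \<subseteq> {..<U} \<Longrightarrow> q \<le> off \<Longrightarrow> off + 3 * int (length xs) \<le> W \<Longrightarrow>
    wp_proc W \<Pi> 5 [p, off, t] M (flatten_post off xs n h)"
proof (induction arbitrary: off rule: tree.induct)
  case Leaf
  have "f \<in> {f..<q}" using Leaf A by blast
  then show ?case
    using progs Leaf table q by (simp add: wp_proc_def flatten_proc_def flatten_post_def)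
next
  case (Node p1 xs1 n1 h1 p2 xs2 n2 h2 p own)
  note r1 = tree_root[OF Node.hyps(1)] and r2 = tree_root[OF Node.hyps(2)]
  define xs where "xs = own @ xs1 @ xs2"
  define L where "L = int (length xs1)"
  have IH1: "wp_proc W \<Pi> 5 [p1, off + 3 * int (length own), t] M
      (flatten_post (off + 3 * int (length own)) xs1 n1 h1)"
    by (rule Node.IH(1)) (use Node.prems in auto)
  have IH2: "wp_proc W \<Pi> 5 [p2, off + 3 * int (length own) + 3 * L, t] M
      (flatten_post (off + 3 * int (length own) + 3 * L) xs2 n2 h2)"
    by (rule Node.IH(2)) (use Node.prems in \<open>auto simp: L_def\<close>)
  have adr: "p \<in> {f..<q}" "p + 1 \<in> {f..<q}" "p + 2 \<in> {f..<q}" "p + 3 \<in> {f..<q}" "p1 \<in> {f..<q}" "p2 \<in> {f..<q}"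
    using Node.hyps(3) A r1(1) r2(1) by fastforce+
  have f0: "0 \<le> f" using table by linarith
  have len: "int (length xs) = int (length own) + L + int (length xs2)" unfolding xs_def L_def by simp
  have fits: "\<bar>p\<bar> \<le> W" "\<bar>p + 1\<bar> \<le> W" "\<bar>p + 2\<bar> \<le> W" "\<bar>p + 3\<bar> \<le> W" "p \<le> W" "p1 \<le> W" "\<bar>p1\<bar> \<le> W" "\<bar>p2\<bar> \<le> W"
     "\<bar>off\<bar> \<le> W" "\<bar>t\<bar> \<le> W" "\<bar>L\<bar> \<le> W" "\<bar>3 * L\<bar> \<le> W" "\<bar>off + 3 * L\<bar> \<le> W" "3 \<le> W" "off + 3 * int (length xs) \<le> W" "int (length xs) \<le> W"
    using adr f0 q Node.prems(2,3) table len unfolding xs_def[symmetric] L_def by auto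
  show ?case
  proof (cases "xs = []")
    case True
    then show ?thesis
      using progs Node.hyps(4) adr fits
      by (simp add: wp_proc_def flatten_proc_def flatten_post_def xs_def)
  next
    case False
    have root: "M p = int (length xs)" "M p1 = L"
      using Node.hyps(4) r1(2) unfolding xs_def L_def by auto
    have race: "X1 \<inter> (R2 \<union> X2) = {} \<and> X2 \<inter> (R1 \<union> X1) = {}"
      if "flatten_post (off + 3 * int (length own)) xs1 n1 h1 v1 M1 w1 e1 R1 X1"
        "flatten_post (off + 3 * int (length own) + 3 * L) xs2 n2 h2 v2 M2 w2 e2 R2 X2"
      for v1 M1 w1 e1 R1 X1 v2 M2 w2 e2 R2 X2
      using that Node.prems(2) unfolding flatten_post_def L_def by fastforce
    have join: "written X D M' (off + 3 * int (length own)) (xs1 @ xs2)"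
      if 1: "flatten_post (off + 3 * int (length own)) xs1 n1 h1 v1 M1 w1 e1 R1 X1"
        and 2: "flatten_post (off + 3 * int (length own) + 3 * L) xs2 n2 h2 v2 M2 w2 e2 R2 X2"
        and M': "\<And>a. a \<notin> X2 \<Longrightarrow> M' a = M1 a" "\<And>a. a \<notin> X1 \<Longrightarrow> M' a = M2 a"
      for v1 M1 w1 e1 R1 X1 v2 M2 w2 e2 R2 X2 M'
    proof -
      have X: "X1 \<subseteq> {off + 3 * int (length own)..<off + 3 * int (length own) + 3 * L}"
        "X2 \<subseteq> {off + 3 * int (length own) + 3 * L..<off + 3 * int (length own) + 3 * L + 3 * int (length xs2)}"
        and w: "written X D M1 (off + 3 * int (length own)) xs1"
          "written X D M2 (off + 3 * int (length own) + 3 * L) xs2"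
        using 1 2 unfolding flatten_post_def L_def by simp_all
      have "written X D M' (off + 3 * int (length own)) xs1"
        by (rule written_cong[OF w(1)], rule M'(1)) (use X(2) in \<open>auto simp: L_def\<close>)
      moreover have "written X D M' (off + 3 * int (length own) + 3 * L) xs2"
        by (rule written_cong[OF w(2)], rule M'(2)) (use X(1) in \<open>auto simp: L_def\<close>)
      ultimately show ?thesis by (simp add: written_append L_def)
    qed
    \<comment> \<open>One accounting for both kinds of node: the words of \<open>own\<close>, if
      any, precede the blocks of the two children.\<close>
    have post: "flatten_post off (own @ xs1 @ xs2) (Suc (n1 + n2)) (Suc (max h1 h2)) v M'' w e R Y"
      if 1: "flatten_post (off + 3 * int (length own)) xs1 n1 h1 v1 M1 w1 e1 R1 X1"
        and 2: "flatten_post (off + 3 * int (length own) + 3 * L) xs2 n2 h2 v2 M2 w2 e2 R2 X2"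
        and M': "\<And>a. a \<notin> X2 \<Longrightarrow> M' a = M1 a" "\<And>a. a \<notin> X1 \<Longrightarrow> M' a = M2 a"
        and w: "w \<le> w1 + w2 + 150" "e \<le> max e1 e2 + 150" and R: "R \<subseteq> R1 \<union> R2 \<union> {..<q}"
        and Y: "Y \<subseteq> X1 \<union> X2 \<union> {off..<off + 3 * int (length own)}"
        and M'': "written X D M'' off own" "\<And>a. off + 3 * int (length own) \<le> a \<Longrightarrow> M'' a = M' a"
      for v1 M1 w1 e1 R1 X1 v2 M2 w2 e2 R2 X2 M' v M'' w e R Y
    proof -
      have "written X D M'' (off + 3 * int (length own)) (xs1 @ xs2)"
        by (rule written_cong[OF join[OF 1 2 M']]) (auto intro: M''(2))
      then have "written X D M'' off (own @ xs1 @ xs2)"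
        using M''(1) unfolding written_append by simp
      moreover have "w \<le> (2 * Suc (n1 + n2) + 1) * 150" "e \<le> (Suc (max h1 h2) + 1) * 150"
        using w 1 2 unfolding flatten_post_def by auto
      moreover have "Y \<subseteq> {off..<off + 3 * int (length (own @ xs1 @ xs2))}"
      proof -
        have "X1 \<subseteq> {off..<off + 3 * int (length (own @ xs1 @ xs2))}"
          "X2 \<subseteq> {off..<off + 3 * int (length (own @ xs1 @ xs2))}"
          using 1 2 unfolding flatten_post_def L_def by auto
        then show ?thesis using Y by fastforce
      qed
      moreover have "R \<subseteq> {..<q}" using R 1 2 unfolding flatten_post_def by blast
      ultimately show ?thesis unfolding flatten_post_def by blast
    qed
    show ?thesis
    proof (cases own)
      case Nil
      then have own: "M (p + 3) = -1" using Node.hyps(7) by simp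
      have a: "off + 3 * int (length own) = off" by (simp add: Nil)
      show ?thesis
        using progs fits root Node.hyps(5,6) own False
        apply (simp add: wp_proc_def[of _ _ _ "[p, off, t]"] flatten_proc_def)
        apply (rule wp_Fork[OF _ _ IH1[unfolded a] _ IH2[unfolded a]])
            apply (use fits in simp)
           apply (simp (no_asm))
          apply (simp (no_asm))
         apply (erule (1) race[unfolded a])
        apply (simp (no_asm) add: args_cost_def)
        subgoal premises prems
          by (rule post[unfolded a, OF prems(25-28)]) (use adr Nil in auto)
        done
    next
      case (Cons y ys)
      then have y: "own = [y]" "M (p + 3) = int y" "y < U"
        using Node.hyps(7) Node.prems(1) by auto
      have a: "off + 3 * int (length own) = off + 3" by (simp add: y(1))
      have b: "0 \<le> off" "off + 3 * (1 + L + int (length xs2)) \<le> W" "0 \<le> L"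
        using Node.prems(2,3) f0 adr(1) unfolding L_def y(1) by simp_all
      have c: "0 \<le> t + 2 * int y" "t + 2 * int y + 1 < f" "f < q" "q + 3 \<le> W" "0 \<le> t"
        using y(3) table adr(1) q by simp_all
      have one: "0 \<le> W" "1 \<le> W" "2 \<le> W" using c by simp_all
      have fits2: "\<bar>off + 1\<bar> \<le> W" "\<bar>off + 2\<bar> \<le> W" "\<bar>off + 3\<bar> \<le> W" "\<bar>off + 3 + 3 * L\<bar> \<le> W"
        using b by simp_all
      have fits3: "int y \<le> W" "2 * int y \<le> W" "\<bar>t + 2 * int y\<bar> \<le> W" "\<bar>t + 2 * int y + 1\<bar> \<le> W"
        "t + 2 * int y < q" "t + 2 * int y + 1 < q" "\<bar>X y\<bar> \<le> W" "\<bar>D y\<bar> \<le> W"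
        using c by (simp_all add: X_def D_def M_le)
      have XD: "M (t + 2 * int y) = X y" "M (t + 2 * int y + 1) = D y" by (simp_all add: X_def D_def)
      show ?thesis
        using progs root Node.hyps(5,6) y(2) False
        apply (simp add: wp_proc_def[of _ _ _ "[p, off, t]"] flatten_proc_def XD)
        apply (intro conjI one fits fits2 fits3)
        apply (rule wp_Fork[OF _ _ IH1[unfolded a] _ IH2[unfolded a]])
            apply (simp (no_asm))
            apply (intro conjI one fits fits2 fits3)
           apply (simp (no_asm))
          apply (simp (no_asm))
         apply (erule (1) race[unfolded a])
        apply (simp (no_asm) add: args_cost_def)
        subgoal premises prems for v1 M1 w1 e1 R1 X1 v2 M2 w2 e2 R2 X2 M'
          apply (intro conjI one fits fits2 fits3)
          apply (rule post[unfolded a, OF prems(9-12)])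
          apply (use adr y(1) fits3 in auto)
          done
        done
    qed
  qed
qed

end

section \<open>The complete program\<close>

text \<open>The search runs after \<open>f\<close> has been cleared and the scan has filled its
  table; both write at \<open>f\<close> or beyond, where the input structure has no word.\<close>

lemma veb_at_cong:
  "veb_at M f k a S \<Longrightarrow> (\<And>a. 0 \<le> a \<Longrightarrow> a < f \<Longrightarrow> M' a = M a) \<Longrightarrow> veb_at M' f k a S"
proof (induction k arbitrary: a S rule: less_induct)
  case (less k)
  let ?T = "S - {Min S}"
  have v: "S \<subseteq> {..<2 ^ k}" "0 \<le> a" "a + 5 \<le> f" "M a = int k"
    "M (a + 1) = (if S = {} then -1 else int (Min S))"
    "M (a + 2) = (if S = {} then -1 else int (Max S))"
    using less.prems(1) by (subst (asm) veb_at.simps, simp)+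
  have M': "M' a = M a" "M' (a + 1) = M (a + 1)" "M' (a + 2) = M (a + 2)" "M' (a + 3) = M (a + 3)"
    "M' (a + 4) = M (a + 4)"
    using v(2,3) by (auto intro!: less.prems(2))
  show ?case
  proof (cases "k \<le> 1")
    case True
    then show ?thesis using v M' by (subst veb_at.simps) simp
  next
    case False
    have w: "veb_at M f ((k + 1) div 2) (M (a + 3)) ((\<lambda>y. y div 2 ^ (k div 2)) ` ?T)"
      "0 \<le> M (a + 4)" "M (a + 4) + 2 ^ ((k + 1) div 2) \<le> f"
      "\<And>i. i < 2 ^ ((k + 1) div 2) \<Longrightarrow>
         veb_at M f (k div 2) (M (M (a + 4) + int i)) (cluster ?T (2 ^ (k div 2)) i)"
      using less.prems(1) False by (subst (asm) veb_at.simps, simp)+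
    have "veb_at M' f ((k + 1) div 2) (M (a + 3)) ((\<lambda>y. y div 2 ^ (k div 2)) ` ?T)"
      using False by (intro less.IH[OF _ w(1)] less.prems(2)) auto
    moreover have "veb_at M' f (k div 2) (M' (M (a + 4) + int i)) (cluster ?T (2 ^ (k div 2)) i)"
      if i: "i < 2 ^ ((k + 1) div 2)" for i
    proof -
      have "int i < 2 ^ ((k + 1) div 2)" using i by (metis of_nat_less_iff of_nat_numeral of_nat_power)
      then have "M' (M (a + 4) + int i) = M (M (a + 4) + int i)"
        using w(2,3) by (intro less.prems(2)) linarith+
      moreover have "veb_at M' f (k div 2) (M (M (a + 4) + int i)) (cluster ?T (2 ^ (k div 2)) i)"
        using False by (intro less.IH[OF _ w(4)[OF i]] less.prems(2)) auto
      ultimately show ?thesis by simp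
    qed
    ultimately show ?thesis
      using v w(2,3) False by (subst veb_at.simps) (simp add: M')
  qed
qed

text \<open>The score of the first batch point replaces minus infinity as the initial maximum; an
  empty batch has none and is therefore skipped.\<close>

definition build_code :: com where
  "build_code = Cond (Op Less (Const 0) (Reg 3)) (seqs [
     Load 7 (Op Add (Reg 2) (Const 2)),
     Call 8 3 [Const 0, Reg 3, Reg 2, Reg 4],
     Call 6 4 [Const 0, Reg 3, Reg 7, Reg 0, Reg 1, Reg 2, Reg 3, Reg 4]]) Skip"

text \<open>
  Register 5 holds \<open>k\<close>; as \<open>2 ^ k \<ge> U\<close>, the output address in register 9 lies beyond all tree nodes.
\<close>

definition output_code :: com where
  "output_code = seqs [
     Assign 9 (Op Add (Reg 4) (Op Mul (Const 5) (Op Add (Reg 3) (Op Shl (Const 1) (Reg 5))))),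
     Load 10 (Reg 6),
     Store (Reg 9) (Reg 10),
     Call 11 5 [Reg 6, Op Add (Reg 9) (Const 1), Reg 1],
     Assign 0 (Reg 9)]"

text \<open>Register 6 starts out at the empty tree, so that skipping the construction still leaves
  a valid root.\<close>

definition main_proc :: com where
  "main_proc = seqs [
     Store (Reg 4) (Const 0),
     Load 5 (Reg 0),
     Assign 6 (Reg 4),
     Seq build_code output_code]"

definition covered_prog :: program where
  "covered_prog = [main_proc, succ_proc, key_proc, scan_proc, batch_proc, flatten_proc]"

lemma covered_prog_nth [simp]:
  "length covered_prog = 6" "covered_prog ! 0 = main_proc"
  "covered_prog ! 1 = succ_proc" "covered_prog ! Suc 0 = succ_proc" "covered_prog ! 2 = key_proc"
  "covered_prog ! 3 = scan_proc" "covered_prog ! 4 = batch_proc" "covered_prog ! 5 = flatten_proc"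
  by (simp_all add: covered_prog_def)

section \<open>Assembling the program under the hypotheses of the theorem\<close>

locale query =
  fixes W N :: int and M :: mem and f v t b :: int and U :: nat and P :: "point set" and B :: "point list"
  assumes U: "2 < U" and mono_veb: "mono_veb_at M f U v t P"
    and B: "sorted (map py B)" "\<And>p. p \<in> set B \<Longrightarrow> py p < U" "length B \<le> U"
      "points_at M b B" "0 \<le> b" "b + 3 * int (length B) \<le> f"
    and N: "int U \<le> N" "f \<le> N" "\<And>a. 0 \<le> a \<Longrightarrow> a < f \<Longrightarrow> \<bar>M a\<bar> \<le> N" "50000 * N \<le> W"
begin

abbreviation n :: nat where "n \<equiv> length B"
definition k :: nat where "k = ceillog2 U"
definition J :: nat where "J = ceillog2 k"
definition ys :: "nat \<Rightarrow> nat" where "ys i = py (B ! i)"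
definition dp :: "nat \<Rightarrow> int" where "dp i = pdp (B ! i)"
definition S :: "nat set" where "S = py ` P"

lemma k: "U \<le> 2 ^ k" "(2 :: int) ^ k \<le> 2 * N" "2 \<le> k"
proof -
  show "U \<le> 2 ^ k" unfolding k_def by (rule le_two_power_ceillog2)
  have "2 ^ k < 2 * U" using U unfolding k_def by (intro two_power_ceillog2_gt) simp
  then have "int (2 ^ k) < int (2 * U)" by (simp only: of_nat_less_iff)
  then show "(2 :: int) ^ k \<le> 2 * N" using N(1) by simp
  show "2 \<le> k" using U unfolding k_def by (subst ceillog2_ge_iff) auto
qed

lemma veb: "veb_at M f k v S" and table: "0 \<le> t" "t + 2 * int U \<le> f" and mono: "mono_points U P"
  and data: "\<And>p. p \<in> P \<Longrightarrow> M (t + 2 * int (py p)) = px p \<and> M (t + 2 * int (py p) + 1) = pdp p"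
  using mono_veb unfolding mono_veb_at_def S_def k_def by auto

lemma S: "S \<subseteq> {..<U}" using mono unfolding S_def mono_points_def by auto

lemma scores:
  assumes "x \<in> S" "y \<in> S" "x < y"
  shows "M (t + 2 * int x + 1) < M (t + 2 * int y + 1)"
proof -
  obtain p q where pq: "p \<in> P" "q \<in> P" "x = py p" "y = py q" using assms(1,2) unfolding S_def by blast
  then have "\<not> covers p q" using mono unfolding mono_points_def by blast
  then show ?thesis using assms(3) data pq unfolding covers_def by auto
qed

lemma nN: "int n \<le> N" "3 \<le> N" "0 \<le> f" using B(3) N(1) U table by linarith+

context
  fixes M' :: mem
  assumes M': "\<And>a. 0 \<le> a \<Longrightarrow> a < f \<Longrightarrow> M' a = M a"
begin

lemma batch_mem:
  assumes "i < n"
  shows "M' (b + 3 * int i + 1) = int (ys i)" "M' (b + 3 * int i + 2) = dp i"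
proof -
  have "M' (b + 3 * int i + 1) = M (b + 3 * int i + 1)" "M' (b + 3 * int i + 2) = M (b + 3 * int i + 2)"
    using B(5,6) assms by (auto intro!: M')
  then show "M' (b + 3 * int i + 1) = int (ys i)" "M' (b + 3 * int i + 2) = dp i"
    using B(4) assms unfolding points_at_def ys_def dp_def by auto
qed

lemma M'_le: "0 \<le> a \<Longrightarrow> a < f \<Longrightarrow> \<bar>M' a\<bar> \<le> W"
  using M' N(3)[of a] N(4) nN by simp

lemma scan: "scan W covered_prog M' f b n dp"
  by unfold_locales (use M'_le B(5,6) batch_mem(2) N nN in auto)

lemma batch:
  assumes "M' f = 0" "max_table M' f dp 0 n"
  shows "batch W covered_prog M' f v t b k J U S n dp ys"
proof (intro batch.intro scan mono_keys.intro batch_axioms.intro)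
  fix x y assume xy: "x \<in> S" "y \<in> S" "x < y"
  then have "x < U" "y < U" using S by auto
  then show "M' (t + 2 * int x + 1) < M' (t + 2 * int y + 1)"
    using scores[OF xy] table by (simp add: M')
next
  show "veb_at M' f k v S" by (rule veb_at_cong[OF veb M'])
next
  show "k \<le> 2 ^ J" unfolding J_def by (rule le_two_power_ceillog2)
next
  fix i i' assume "i \<le> i'" "i' < n"
  then show "ys i \<le> ys i'" using B(1) unfolding ys_def by (auto simp: sorted_iff_nth_mono)
next
  fix i assume "i < n"
  then show "ys i < U" using B(2) unfolding ys_def by simp
qed (use M'_le assms k S table N nN batch_mem in auto)

end

lemma score_eq:
  assumes "p \<in> P" "\<And>a. 0 \<le> a \<Longrightarrow> a < f \<Longrightarrow> M' a = M a"
  shows "M' (t + 2 * int (py p)) = px p" "M' (t + 2 * int (py p) + 1) = pdp p"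
proof -
  have "py p < U" using S assms(1) unfolding S_def by auto
  then show "M' (t + 2 * int (py p)) = px p" "M' (t + 2 * int (py p) + 1) = pdp p"
    using table data[OF assms(1)] by (simp_all add: assms(2))
qed

text \<open>For the whole batch, \<open>score s <= d\<close> with \<open>d = dp 0\<close> is just
  the case of point 0. The lower end \<open>ys 0 < s\<close> follows from any covering point by
  sortedness, and the upper end \<open>U - 1\<close> excludes no stored key.\<close>

lemma covered_eq:
  assumes n: "0 < n" and M': "\<And>a. 0 \<le> a \<Longrightarrow> a < f \<Longrightarrow> M' a = M a" "M' f = 0" "max_table M' f dp 0 n"
  shows "batch.covered M' t U S n dp ys 0 n (dp 0) = py ` covered_by P B"
proof -
  interpret batch W covered_prog M' f v t b k J U S n dp ys using batch[OF M'] .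
  have ys0: "ys 0 \<le> ys i" if "i < n" for i using ys(3)[of 0 i] that by simp
  have "s \<in> covered 0 n (dp 0) \<longleftrightarrow> s \<in> S \<and> (\<exists>i<n. ys i < s \<and> score s \<le> dp i)" for s
    using S n ys0 unfolding covered_def E_def by (auto intro: le_less_trans)
  also have "\<dots> s \<longleftrightarrow> s \<in> py ` covered_by P B" for s
  proof
    assume "s \<in> S \<and> (\<exists>i<n. ys i < s \<and> score s \<le> dp i)"
    then obtain i p where ip: "i < n" "p \<in> P" "s = py p" "ys i < s" "score s \<le> dp i"
      unfolding S_def by blast
    then have "covers (B ! i) p"
      using score_eq(2)[OF _ M'(1), of p] unfolding covers_def ys_def dp_def score_def by simp
    then have "p \<in> covered_by P B" using ip(1,2) unfolding covered_by_def by auto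
    then show "s \<in> py ` covered_by P B" using ip(3) by blast
  next
    assume "s \<in> py ` covered_by P B"
    then obtain p q where "q \<in> set B" "covers q p" "p \<in> P" "s = py p"
      unfolding covered_by_def by blast
    moreover from this obtain i where "i < n" "q = B ! i" by (metis in_set_conv_nth)
    ultimately show "s \<in> S \<and> (\<exists>i<n. ys i < s \<and> score s \<le> dp i)"
      using score_eq(2)[OF _ M'(1), of p] unfolding S_def covers_def ys_def dp_def score_def by auto
  qed
  finally show ?thesis by blast
qed

definition unit_cost :: nat where "unit_cost = 300 * (J + 1) + 300"

text \<open>\<open>4 * n\<close> is \<open>3 * n\<close> for the batch recursion and
  \<open>n\<close> for the scan; \<open>3 * k + 3\<close> is \<open>2 * k + 2\<close> and
  \<open>k + 1\<close>, respectively. Both batch depths are at most \<open>k\<close> because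
  \<open>n <= U <= 2 ^ k\<close>. Registers up to 5 are needed again for the output.\<close>

definition build_post where
  "build_post \<sigma> M0 = (\<lambda>\<sigma>' M' w e (R :: int set) (X :: int set). (\<forall>i\<le>5. \<sigma>' i = \<sigma> i) \<and> (\<forall>a. 0 \<le> a \<and> a < f \<longrightarrow> M' a = M0 a) \<and>
     (\<exists>xs n' h. tree M' f {f..<f + 5 * (int n + int U)} (\<sigma>' 6) xs n' h \<and> n' \<le> length xs + n \<and> h \<le> 2 * k \<and>
        sorted_wrt (<) xs \<and> set xs = py ` covered_by P B \<and>
        w \<le> (2 * length xs + 4 * n) * unit_cost + 10 \<and> e \<le> (3 * k + 3) * unit_cost + 10))"

lemma wp_build:
  assumes M0: "\<And>a. 0 \<le> a \<Longrightarrow> a < f \<Longrightarrow> M0 a = M a" "M0 f = 0"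
    and regs: "\<sigma> 0 = v" "\<sigma> 1 = t" "\<sigma> 2 = b" "\<sigma> 3 = int n" "\<sigma> 4 = f" "\<sigma> 6 = f"
  shows "wp W covered_prog build_code \<sigma> M0 (build_post \<sigma> M0)"
proof (cases "n = 0")
  case True
  then have *: "tree M0 f {f..<f + 5 * (int n + int U)} f [] 0 0" "covered_by P B = {}"
    using U M0(2) by (auto intro!: tree.Leaf simp: covered_by_def)
  have "build_post \<sigma> M0 \<sigma> M0 w e R X" if "w \<le> 10" "e \<le> 10" for w e R X
    unfolding build_post_def using * that regs(6)
    by (intro conjI allI impI refl exI[of _ "[]"] exI[of _ 0]) auto
  then show ?thesis
    using N nN by (simp add: build_code_def regs True)
next
  case False
  interpret scan W covered_prog M0 f b n dp using scan[OF M0(1)] .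
  have nk: "n - 0 \<le> 2 ^ k" using B(3) k(1) by simp
  have sc: "wp_proc W covered_prog 3 [0, int n, b, f] M0 (scan_post 0 n k)"
    using wp_proc_scan[of 0 n k] False nk by simp
  have bt: "wp_proc W covered_prog 4 [0, int n, dp 0, v, t, b, int n, f] M1 (\<lambda>r M' w e R X.
      \<forall>\<sigma>' w' e' R' X'. (\<forall>i\<le>5. \<sigma>' i = \<sigma> i) \<longrightarrow> \<sigma>' 6 = r \<longrightarrow> w' \<le> w + w1 + 40 \<longrightarrow> e' \<le> e + e1 + 40 \<longrightarrow>
        build_post \<sigma> M0 \<sigma>' M' w' e' R' X')"
    if "scan_post 0 n k v1 M1 w1 e1 R1 X1" "\<And>a. a \<notin> X1 \<Longrightarrow> M1 a = M0 a" for v1 M1 w1 e1 R1 X1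
  proof -
    have X1: "X1 \<subseteq> {f + 5..<f + 5 * int n}" and w1: "w1 \<le> 2 * n * 60" "e1 \<le> (k + 1) * 60"
      and tab: "max_table M1 f dp 0 n"
      using that(1) unfolding scan_post_def by auto
    have M1': "M1 a = M0 a" if "a \<le> f" for a
    proof -
      have "a \<notin> X1" using X1 that by fastforce
      then show ?thesis using \<open>\<And>a. a \<notin> X1 \<Longrightarrow> M1 a = M0 a\<close> by blast
    qed
    have M1: "\<And>a. 0 \<le> a \<Longrightarrow> a < f \<Longrightarrow> M1 a = M a" "M1 f = 0"
      using M1' M0 by simp_all
    interpret B: batch W covered_prog M1 f v t b k J U S n dp ys using batch[OF M1 tab] .
    have E: "B.E n = int U - 1" by (simp add: B.E_def)
    have reg: "{f} \<union> B.batch_region 0 n \<subseteq> {f..<f + 5 * (int n + int U)}"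
      using U unfolding B.batch_region_def B.key_region_def E by auto
    have cov: "B.covered 0 n (dp 0) = py ` covered_by P B"
      by (rule covered_eq[OF _ M1 tab]) (use False in simp)
    have "wp_proc W covered_prog 4 [int 0, int n, dp 0, v, t, b, int n, f] M1 (B.batch_post 0 n (dp 0) k)"
      by (rule B.wp_proc_batch) (use False nk tab dp_le[of 0] in auto)
    then have bt: "wp_proc W covered_prog 4 [0, int n, dp 0, v, t, b, int n, f] M1 (B.batch_post 0 n (dp 0) k)"
      by simp
    show ?thesis
    proof (rule wp_proc_mono[OF bt], intro allI impI)
      fix r M' w e R X \<sigma>' w' e' R' X'
      assume fr: "\<And>a. a \<notin> X \<Longrightarrow> M' a = M1 a" and post: "B.batch_post 0 n (dp 0) k r M' w e R X"
        and \<sigma>': "\<forall>i\<le>5. \<sigma>' i = \<sigma> i" "\<sigma>' 6 = r" and w': "w' \<le> w + w1 + 40" "e' \<le> e + e1 + 40"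
      from post obtain xs n' h where p: "tree M' f ({f} \<union> B.batch_region 0 n) r xs n' h"
        "n' < length xs + n" "h \<le> 2 * k" "sorted_wrt (<) xs" "set xs = py ` covered_by P B"
        "w + unit_cost \<le> (2 * length xs + 3 * n) * unit_cost" "e \<le> (k + k + 2) * unit_cost"
        "X \<subseteq> B.batch_region 0 n"
        unfolding B.batch_post_def cov unit_cost_def[symmetric] by (auto simp: unit_cost_def[symmetric])
      have "M' a = M0 a" if "0 \<le> a" "a < f" for a
      proof -
        have "a \<notin> X" using p(8) that unfolding B.batch_region_def B.key_region_def by fastforce
        then show ?thesis using fr M1'[of a] that by simp
      qed
      moreover have "tree M' f {f..<f + 5 * (int n + int U)} (\<sigma>' 6) xs n' h"
        unfolding \<sigma>'(2) by (rule tree_mono[OF p(1) _ reg]) simp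
      moreover have "w' \<le> (2 * length xs + 4 * n) * unit_cost + 10"
      proof -
        have "w' \<le> A + n * unit_cost + 10" if "w + unit_cost \<le> A" for A
        proof -
          have "n * 120 \<le> n * unit_cost" by (intro mult_le_mono2) (simp add: unit_cost_def)
          moreover have "30 \<le> unit_cost" by (simp add: unit_cost_def)
          ultimately show ?thesis using that w1(1) w'(1) by linarith
        qed
        from this[OF p(6)] show ?thesis by (simp add: algebra_simps)
      qed
      moreover have "e' \<le> (3 * k + 3) * unit_cost + 10"
      proof -
        have "(k + 1) * 60 + 40 \<le> (k + 1) * unit_cost" by (simp add: unit_cost_def algebra_simps)
        then have "e' \<le> (k + k + 2) * unit_cost + (k + 1) * unit_cost" using p(7) w1(2) w'(2) by linarith
        then show ?thesis by (simp add: algebra_simps)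
      qed
      ultimately show "build_post \<sigma> M0 \<sigma>' M' w' e' R' X'"
        unfolding build_post_def using \<sigma>'(1) p(2-5)
        by - (intro conjI allI impI, simp, simp, rule exI[of _ xs], rule exI[of _ n'], rule exI[of _ h], simp)
    qed
  qed
  have vf: "0 \<le> v" "v + 5 \<le> f" using veb by (subst (asm) veb_at.simps, simp)+
  have fits: "0 \<le> W" "\<bar>b\<bar> \<le> W" "\<bar>f\<bar> \<le> W" "\<bar>v\<bar> \<le> W" "\<bar>t\<bar> \<le> W" "int n \<le> W" "1 \<le> W" "2 \<le> W" "\<bar>b + 2\<bar> \<le> W" "\<bar>dp 0\<bar> \<le> W"
    using False N nN B(5,6) table vf dp_le[of 0] by auto
  have rd: "M0 (b + 2) = dp 0" using dp[of 0] False by simp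
  show ?thesis
    using False
    apply (simp add: build_code_def regs rd regs(2)[unfolded One_nat_def])
    apply (intro conjI fits)
    apply (rule wp_proc_mono[OF sc])
    apply (intro conjI fits)
    apply (rule wp_proc_mono[OF bt])
      apply assumption
     apply assumption
    apply (simp add: args_cost_def)
    done
qed

definition X :: "nat \<Rightarrow> int" where "X y = M (t + 2 * int y)"
definition D :: "nat \<Rightarrow> int" where "D y = M (t + 2 * int y + 1)"

lemma wp_output:
  assumes T: "tree M2 f {f..<f + 5 * (int n + int U)} p xs n' h" "set xs \<subseteq> {..<U}" "int (length xs) \<le> N"
    and M2: "\<And>a. 0 \<le> a \<Longrightarrow> a < f \<Longrightarrow> M2 a = M a"
    and regs: "\<sigma> 1 = t" "\<sigma> 3 = int n" "\<sigma> 4 = f" "\<sigma> 5 = int k" "\<sigma> 6 = p"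
  shows "wp W covered_prog output_code \<sigma> M2 (\<lambda>\<sigma>' M' w e R Y.
    M' (\<sigma>' 0) = int (length xs) \<and> written X D M' (\<sigma>' 0 + 1) xs \<and>
    w \<le> (2 * n' + 1) * 150 + 50 \<and> e \<le> (h + 1) * 150 + 50)"
proof -
  define r where "r = f + 5 * (int n + 2 ^ k)"
  define M3 where "M3 = M2(r := int (length xs))"
  have Uk: "int U \<le> 2 ^ k"
    using of_nat_mono[OF k(1), where 'a = int] by (simp only: of_nat_power of_nat_numeral)
  \<comment> \<open>16 is 1 + 5 + 10, from \<open>f <= N\<close>, \<open>n <= N\<close> and
    \<open>2 ^ k <= 2 * N\<close>; so a constant multiple of \<open>N\<close> suffices as word
    bound.\<close>
  have r: "f + 5 * (int n + int U) \<le> r" "r \<le> 16 * N"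
    using Uk k(2) N(2) nN unfolding r_def distrib_left by linarith+
  have M3: "M3 a = M a" if "0 \<le> a" "a < f" for a
    using that r U M2 unfolding M3_def by auto
  have fl: "flatten W covered_prog M3 f t (r + 1) U {f..<f + 5 * (int n + int U)}"
    by unfold_locales (use r N nN table M'_le[OF M3] in auto)
  interpret F: flatten W covered_prog M3 f t "r + 1" U "{f..<f + 5 * (int n + int U)}" by (rule fl)
  have T3: "tree M3 f {f..<f + 5 * (int n + int U)} p xs n' h"
    by (rule tree_mono[OF T(1)]) (use r in \<open>auto simp: M3_def\<close>)
  have flat: "wp_proc W covered_prog 5 [p, r + 1, t] M3 (F.flatten_post (r + 1) xs n' h)"
    by (rule F.wp_proc_flatten[OF T3 T(2)]) (use r N nN T(3) in auto)
  have top: "M2 p = int (length xs)" "p \<in> {f..<f + 5 * (int n + int U)}"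
    using tree_root[OF T(1)] by auto
  have XD: "written X D M' a ys" if "written F.X F.D M' a ys" "set ys \<subseteq> {..<U}" for M' a ys
    using that
  proof (induction ys arbitrary: a)
    case (Cons y ys)
    then show ?case using table by (auto simp: F.X_def F.D_def X_def D_def M3)
  qed simp
  have "k < 2 ^ k" by simp
  then have "int k < int (2 ^ k)" by (simp only: of_nat_less_iff)
  then have kW: "int k \<le> 2 ^ k" "0 \<le> (2 :: int) ^ k" by simp_all
  then have kW': "int k \<le> W" using k(2) N(4) nN by linarith
  have fits: "0 \<le> W" "1 \<le> W" "5 \<le> W" "\<bar>f\<bar> \<le> W" "int n \<le> W" "\<bar>int k\<bar> \<le> W" "int k \<le> W"  "\<bar>r\<bar> \<le> W" "\<bar>r + 1\<bar> \<le> W" "\<bar>p\<bar> \<le> W"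
    "\<bar>t\<bar> \<le> W" "2 ^ k \<le> W" "int n + 2 ^ k \<le> W" "5 * int n + 5 * 2 ^ k \<le> W"
    "int (length xs) \<le> W"
    using kW kW' r N nN top T(3) table k(2) unfolding r_def by auto
  have fin: "M' r = int (length xs) \<and> written X D M' (r + 1) xs \<and>
      w \<le> (2 * n' + 1) * 150 \<and> e \<le> (h + 1) * 150"
    if "F.flatten_post (r + 1) xs n' h p' M' w e R Y" "\<And>a. a \<notin> Y \<Longrightarrow> M' a = M3 a" for p' M' w e R Y
  proof -
    have "r \<notin> Y" using that(1) unfolding F.flatten_post_def by fastforce
    then have "M' r = int (length xs)" using that(2) unfolding M3_def by simp
    then show ?thesis using that(1) XD T(2) unfolding F.flatten_post_def by blast
  qed
  have r_eq: "f + (5 * int n + 5 * 2 ^ k) = r" unfolding r_def by (simp add: distrib_left)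
  show ?thesis
    apply (simp add: output_code_def regs regs(1)[unfolded One_nat_def] top r_eq)
    apply (intro conjI fits)
    apply (rule wp_proc_mono[OF flat[unfolded M3_def]])
    subgoal premises prems for v M' w e R Y
      using fin[OF prems(2)[folded M3_def]] prems(1) fits by (simp add: args_cost_def M3_def)
    done
qed

definition answer :: "int \<Rightarrow> mem \<Rightarrow> nat \<Rightarrow> nat \<Rightarrow> bool" where
  "answer r M' w e \<longleftrightarrow> (\<exists>xs. sorted_wrt (<) xs \<and> set xs = py ` covered_by P B \<and>
     M' r = int (length xs) \<and> written X D M' (r + 1) xs \<and>
     w \<le> (2 * length xs + 4 * n) * unit_cost + (2 * (length xs + n) + 1) * 150 + 100 \<and>
     e \<le> (3 * k + 3) * unit_cost + (2 * k + 1) * 150 + 100)"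

lemma run_covered_prog:
  "\<exists>r M' w e. run W covered_prog [v, t, b, int n, f] M r M' w e \<and> answer r M' w e"
proof -
  have vf: "0 \<le> v" "v + 5 \<le> f" "M v = int k" using veb by (subst (asm) veb_at.simps, simp)+
  have fits: "0 \<le> W" "\<bar>f\<bar> \<le> W" "\<bar>v\<bar> \<le> W" using vf N nN by auto
  have rd: "(M(f := 0)) v = int k" using vf by simp
  have out: "wp W covered_prog output_code \<sigma>' M2 (\<lambda>\<sigma>'' M' w e R Y.
      \<forall>w'' e''. w'' \<le> w + w' + 30 \<longrightarrow> e'' \<le> e + e' + 30 \<longrightarrow> answer (\<sigma>'' 0) M' w'' e'')"
    if "build_post ((frame [v, t, b, int n, f])(5 := int k, 6 := f)) (M(f := 0)) \<sigma>' M2 w' e' R' Y'"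
    for \<sigma>' M2 w' e' R' Y'
  proof -
    from that obtain xs n' h where *: "\<And>i. i \<le> 5 \<Longrightarrow> \<sigma>' i = ((frame [v, t, b, int n, f])(5 := int k, 6 := f)) i"
      "\<And>a. 0 \<le> a \<Longrightarrow> a < f \<Longrightarrow> M2 a = M a"
      "tree M2 f {f..<f + 5 * (int n + int U)} (\<sigma>' 6) xs n' h" "n' \<le> length xs + n" "h \<le> 2 * k"
      "sorted_wrt (<) xs" "set xs = py ` covered_by P B"
      "w' \<le> (2 * length xs + 4 * n) * unit_cost + 10" "e' \<le> (3 * k + 3) * unit_cost + 10"
      unfolding build_post_def by auto
    have sub: "set xs \<subseteq> {..<U}"
      using S unfolding *(7) S_def covered_by_def by auto
    have "length xs = card (set xs)" using *(6) by (simp add: strict_sorted_iff distinct_card)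
    also have "\<dots> \<le> card {..<U}" using sub by (intro card_mono) auto
    finally have len: "int (length xs) \<le> N" using N(1) by simp
    have O: "wp W covered_prog output_code \<sigma>' M2 (\<lambda>\<sigma>'' M' w e R Y.
      M' (\<sigma>'' 0) = int (length xs) \<and> written X D M' (\<sigma>'' 0 + 1) xs \<and>
      w \<le> (2 * n' + 1) * 150 + 50 \<and> e \<le> (h + 1) * 150 + 50)"
      by (rule wp_output[OF *(3) sub len *(2)])
        (use *(1)[of 1] *(1)[of 3] *(1)[of 4] *(1)[of 5] in simp_all)
    show ?thesis
    proof (rule wp_mono[OF O], goal_cases)
      case (1 \<sigma>'' M' w e R Y)
      then have w: "w \<le> (2 * n' + 1) * 150 + 50" "e \<le> (h + 1) * 150 + 50" by auto
      have "w + w' + 30 \<le> (2 * length xs + 4 * n) * unit_cost + (2 * (length xs + n) + 1) * 150 + 100"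
        using w(1) *(4,8) by simp
      moreover have "e + e' + 30 \<le> (3 * k + 3) * unit_cost + (2 * k + 1) * 150 + 100"
        using w(2) *(5,9) by simp
      ultimately show ?case using *(6,7) 1 unfolding answer_def
        by (intro allI impI exI[of _ xs] conjI) (auto intro: order_trans)
    qed
  qed
  have "wp W covered_prog main_proc (frame [v, t, b, int n, f]) M (\<lambda>\<sigma>' M' w e R Y. answer (\<sigma>' 0) M' w e)"
    using rd
    apply (simp add: main_proc_def)
    apply (intro conjI fits)
    apply (rule wp_mono[OF wp_build])
            apply (simp_all (no_asm_simp))
    subgoal for \<sigma>' M2 w e R Y
      apply (rule wp_mono[OF out])
       apply assumption
      subgoal premises prems
        by (rule prems(5)[rule_format]) simp_all
      done
    done
  then obtain \<sigma>' M' w e R Y where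
    ex: "exec W covered_prog (main_proc, frame [v, t, b, int n, f], M) (\<sigma>', M', w, e, R, Y)"
    and post: "answer (\<sigma>' 0) M' w e"
    by (rule wpE)
  have "run W covered_prog [v, t, b, int n, f] M (\<sigma>' 0) M' w e"
    using ex unfolding run_def by auto
  then show ?thesis using post by blast
qed

end

theorem theoremD1:
  shows "\<exists>(\<Pi> :: program) (C :: nat).
    \<forall>(U :: nat) (P :: point set) (B :: point list) (M :: mem)
      (v :: int) (t :: int) (b :: int) (f :: int) (N :: int) (W :: int).
      2 < U \<longrightarrow>
      mono_veb_at M f U v t P \<longrightarrow>
      sorted (map py B) \<longrightarrow> (\<forall>p \<in> set B. py p < U) \<longrightarrow> length B \<le> U \<longrightarrow>
      points_at M b B \<longrightarrow> 0 \<le> b \<longrightarrow> b + 3 * int (length B) \<le> f \<longrightarrow>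
      int U \<le> N \<longrightarrow> f \<le> N \<longrightarrow> (\<forall>a. 0 \<le> a \<and> a < f \<longrightarrow> \<bar>M a\<bar> \<le> N) \<longrightarrow> int C * N \<le> W \<longrightarrow>
      (\<exists>(r :: int) (M' :: mem) (work :: nat) (depth :: nat) (Bout :: point list).
        run W \<Pi> [v, t, b, int (length B), f] M r M' work depth \<and>
        set Bout = covered_by P B \<and> sorted_wrt (<) (map py Bout) \<and>
        M' r = int (length Bout) \<and> points_at M' (r + 1) Bout \<and>
        real work \<le> real C * real (max 1 (length B + card (covered_by P B)))
                       * log 2 (log 2 (real U)) \<and>
        real depth \<le> real C * log 2 (real U) * log 2 (log 2 (real U)))"
proof (intro exI[of _ covered_prog] exI[of _ "50000 :: nat"] allI impI)
  fix U :: nat and P :: "point set" and B :: "point list" and M :: mem and v t b f N W :: int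
  assume "2 < U" "mono_veb_at M f U v t P" "sorted (map py B)" "\<forall>p \<in> set B. py p < U"
    "length B \<le> U" "points_at M b B" "0 \<le> b" "b + 3 * int (length B) \<le> f"
    "int U \<le> N" "f \<le> N" "\<forall>a. 0 \<le> a \<and> a < f \<longrightarrow> \<bar>M a\<bar> \<le> N" "int 50000 * N \<le> W"
  then interpret query W N M f v t b U P B by unfold_locales auto
  obtain r M' w e xs where run: "run W covered_prog [v, t, b, int n, f] M r M' w e"
    and xs: "sorted_wrt (<) xs" "set xs = py ` covered_by P B"
    and out: "M' r = int (length xs)" "written X D M' (r + 1) xs"
    and w: "w \<le> (2 * length xs + 4 * n) * unit_cost + (2 * (length xs + n) + 1) * 150 + 100"
    and e: "e \<le> (3 * k + 3) * unit_cost + (2 * k + 1) * 150 + 100"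
    using run_covered_prog unfolding answer_def by blast
  define Bout where "Bout = map (\<lambda>y. (X y, y, D y)) xs"
  have point: "(X (py p), py p, D (py p)) = p" if "p \<in> P" for p
    using data[OF that] unfolding X_def D_def by (cases p) simp
  have sub: "covered_by P B \<subseteq> P" unfolding covered_by_def by auto
  have set: "set Bout = covered_by P B"
    using point sub unfolding Bout_def by (force simp: xs(2))
  have lenB: "length Bout = length xs" unfolding Bout_def by simp
  have map: "map py Bout = xs" unfolding Bout_def by (simp add: comp_def)
  have "distinct Bout" using xs(1) unfolding map[symmetric] by (simp add: strict_sorted_iff distinct_map)
  then have len: "length xs = card (covered_by P B)"
    using distinct_card[of Bout] unfolding set by (simp add: Bout_def)
  \<comment> \<open>Since \<open>J <= L + 2\<close>, the unit cost is at most
    \<open>300 * L + 1200\<close>, which is below \<open>2700 * L\<close> once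
    \<open>L >= 1/2\<close>. The work factor is then \<open>7 * 2700\<close> and the span factor
    \<open>8 * 2 * 2700 = 43200\<close>, which is where 50000 comes from.\<close>
  define L where "L = log 2 (log 2 (real U))"
  have cost: "real unit_cost \<le> 2700 * L" "real k \<le> 2 * log 2 (real U)" "0 \<le> L"
  proof -
    have U1: "1 \<le> log 2 (real U)" using U by (subst le_log_iff) auto
    have "real k < log 2 (real U) + 1" unfolding k_def using U by (intro ceillog2_less_log) simp
    then show k2: "real k \<le> 2 * log 2 (real U)" using U1 by simp
    \<comment> \<open>Additive constants can be absorbed because \<open>U >= 3\<close> keeps
      \<open>L\<close> away from 0: \<open>U ^ 2 >= 9\<close> yields \<open>log 2 U >= 3/2\<close>,
      and \<open>(3/2) ^ 2 > 2\<close> then yields \<open>L >= 1/2\<close>.\<close>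
    have "3 = log 2 (2 ^ 3 :: real)" by (subst log_nat_power) auto
    also have "\<dots> \<le> log 2 (real U ^ 2)"
    proof (subst log_le_cancel_iff)
      have "(3 :: real) ^ 2 \<le> real U ^ 2" using U by (intro power_mono) auto
      then show "(2 :: real) ^ 3 \<le> real U ^ 2" by simp
    qed (use U in auto)
    also have "\<dots> = 2 * log 2 (real U)" using U by (simp add: log_nat_power)
    finally have U2: "3 / 2 \<le> log 2 (real U)" by simp
    have "1 = log 2 (2 :: real)" by simp
    also have "\<dots> \<le> log 2 ((3 / 2) ^ 2)" by (subst log_le_cancel_iff) (auto simp: power2_eq_square)
    also have "\<dots> = 2 * log 2 (3 / 2)" by (simp add: log_nat_power)
    finally have "1 / 2 \<le> log 2 (3 / 2 :: real)" by simp
    also have "\<dots> \<le> L" unfolding L_def using U2 by (subst log_le_cancel_iff) auto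
    finally have L: "1 / 2 \<le> L" .
    then show "0 \<le> L" by simp
    have "real J < log 2 (real k) + 1" unfolding J_def using k(3) by (intro ceillog2_less_log) simp
    also have "log 2 (real k) \<le> log 2 (2 * log 2 (real U))"
      using k2 k(3) U1 by (subst log_le_cancel_iff) auto
    also have "\<dots> = 1 + L" unfolding L_def using U1 by (subst log_mult) auto
    finally have "real J \<le> 2 + L" by simp
    then show "real unit_cost \<le> 2700 * L" using L unfolding unit_cost_def by simp
  qed
  \<comment> \<open>The maximum with 1 pays for the constant work on an empty batch.\<close>
  define m where "m = max 1 (n + card (covered_by P B))"
  have unit_ge: "550 \<le> unit_cost" unfolding unit_cost_def by simp
  have "w \<le> 7 * m * unit_cost"
  proof -
    have m: "length xs + n \<le> m" "1 \<le> m" unfolding m_def len by auto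
    have "(2 * length xs + 4 * n) * unit_cost \<le> 4 * m * unit_cost" using m(1) by (intro mult_le_mono1) simp
    moreover have "(2 * (length xs + n) + 1) * 150 + 100 \<le> m * 550" using m by simp
    moreover have "m * 550 \<le> m * unit_cost" using unit_ge by (rule mult_le_mono2)
    ultimately have "w \<le> 4 * m * unit_cost + m * unit_cost" using w by linarith
    then show ?thesis by simp
  qed
  then have "real w \<le> 7 * real m * real unit_cost" by (metis of_nat_le_iff of_nat_mult of_nat_numeral)
  also have "\<dots> \<le> 7 * real m * (2700 * L)" using cost by (intro mult_left_mono) auto
  also have "\<dots> \<le> real 50000 * real m * L" using cost(3) by (simp add: mult_right_mono)
  finally have work: "real w \<le> real 50000 * real m * L" .
  have "e \<le> 8 * k * unit_cost"
  proof -
    have "(3 * k + 3) * unit_cost \<le> 6 * k * unit_cost" using k(3) by (intro mult_le_mono1) simp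
    moreover have "(2 * k + 1) * 150 + 100 \<le> k * 550" using k(3) by simp
    moreover have "k * 550 \<le> k * unit_cost" using unit_ge by (rule mult_le_mono2)
    ultimately have "e \<le> 6 * k * unit_cost + k * unit_cost" using e by linarith
    then show ?thesis by simp
  qed
  then have "real e \<le> 8 * real k * real unit_cost" by (metis of_nat_le_iff of_nat_mult of_nat_numeral)
  also have "\<dots> \<le> 8 * (2 * log 2 (real U)) * (2700 * L)" using cost by (intro mult_mono) auto
  also have "\<dots> \<le> real 50000 * log 2 (real U) * L" using cost by (simp add: mult_right_mono)
  finally have depth: "real e \<le> real 50000 * log 2 (real U) * L" .
  show "\<exists>r M' work depth Bout. run W covered_prog [v, t, b, int (length B), f] M r M' work depth \<and>
      set Bout = covered_by P B \<and> sorted_wrt (<) (map py Bout) \<and>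
      M' r = int (length Bout) \<and> points_at M' (r + 1) Bout \<and>
      real work \<le> real 50000 * real (max 1 (length B + card (covered_by P B))) * log 2 (log 2 (real U)) \<and>
      real depth \<le> real 50000 * log 2 (real U) * log 2 (log 2 (real U))"
    using run set xs(1)[folded map] out(1)[folded lenB] written_points_at[OF out(2), folded Bout_def]
      work[unfolded m_def L_def] depth[unfolded L_def]
    by blast
qed

end
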